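(* Let $\{\lambda_j\}_j$ be a sequence of positive numbers with $\lambda_j=\varepsilon_j/\delta_j\to+\infty$, where $\varepsilon_j,\delta_j>0$ and $\varepsilon_j\to0$, $\delta_j\to0$. Let $T>0$, let $\rho:\mathbb{R}^d\to[0,+\infty)$ be a Borel function in $L^1(\mathbb{R}^d)\cap L^\infty(\mathbb{R}^d)$ supported on $B_T$, such that there exist $c_0,r_0>0$ with $\rho(\xi)\ge c_0$ for almost every $\xi\in B_{r_0}$, and such that $\int_{\mathbb{R}^d}\rho(\xi)|\xi|^2\,d\xi<+\infty$. Let $a$ be a non-constant $Q_1$-periodic function on $\mathbb{R}^d$ such that $0<\alpha\le a(x)\le\beta<+\infty$ for almost every $x\in\mathbb{R}^d$, for some constants $\alpha,\beta$. Let $M\in\mathbb{R}^d$, $M\ne0$, and, for all $j\in\mathbb{N}$, let $u_j$ be a minimizer for $$\inf\Bigl\{\int_{B_T}\rho(\xi)\int_{Q_1}a(x)\Bigl|\frac{u(x+\lambda_j\xi)-u(x)}{\lambda_j}\Bigr|^2\,dx\,d\xi:\ u\in L^2_{\#,M}(Q_1)\Bigr\},$$ let $v_j(x):=u_j(x)-Mx$, and let $$V_j(x,\xi):=\frac{v_j(x+\xi)-v_j(x)}{\lambda_j}.$$ If $V_j\rightharpoonup0$ weakly in $L^2(Q_1\times Q_1)$ as $j\to+\infty$, then $$\int_{B_T}\rho(\xi)\,M\xi\,d\xi=0.$$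
   Context: The setting is scalar: $M\in\mathbb{R}^d$ is regarded as a row vector ($1\times d$ matrix), so $Mx$ and $M\xi$ denote the scalar products with $M$. $Q_1:=(0,1)^d$, and $B_r$ is the Euclidean ball of $\mathbb{R}^d$ centred at $0$ with radius $r$. A function $u$ on $\mathbb{R}^d$ is $Q_1$-periodic if $u(x+e_i)=u(x)$ for almost every $x$ and every vector $e_i$ of the canonical basis. $L^2_{\#,M}(Q_1):=\{u\in L^2_{\rm loc}(\mathbb{R}^d): u-Mx\text{ is }Q_1\text{-periodic}\}$. "Non-constant" means not almost everywhere equal to a constant; $a$ is measurable. *)

theory Defs
  imports "HOL-Analysis.Analysis"
begin

text \<open>Elements of \<open>L\<^sup>2\<close> spaces are represented by functions, so equalities between them
  hold up to Lebesgue-null sets.\<close>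

definition unit_cube :: "(real ^ 'n) set" where
  "unit_cube = {x. \<forall>i. 0 < x $ i \<and> x $ i < 1}"

definition cube_periodic :: "(real ^ 'n \<Rightarrow> real) \<Rightarrow> bool" where
  "cube_periodic f \<longleftrightarrow> (\<forall>i. AE x in lebesgue. f (x + axis i 1) = f x)"

definition L2_on :: "'a::euclidean_space set \<Rightarrow> ('a \<Rightarrow> real) set" where
  "L2_on S = {f \<in> borel_measurable (lebesgue_on S). integrable (lebesgue_on S) (\<lambda>x. (f x)\<^sup>2)}"

definition L2_loc :: "('a::euclidean_space \<Rightarrow> real) set" where
  "L2_loc = {f \<in> borel_measurable lebesgue. \<forall>K. compact K \<longrightarrow> f \<in> L2_on K}"

definition L2_per :: "real ^ 'n \<Rightarrow> (real ^ 'n \<Rightarrow> real) set" where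
  "L2_per M = {u \<in> L2_loc. cube_periodic (\<lambda>x. u x - M \<bullet> x)}"

text \<open>Weak convergence in \<open>L\<^sup>2(S)\<close>, with the dual identified with \<open>L\<^sup>2(S)\<close> itself.\<close>

definition weakly_converges_L2 ::
  "'a::euclidean_space set \<Rightarrow> (nat \<Rightarrow> 'a \<Rightarrow> real) \<Rightarrow> ('a \<Rightarrow> real) \<Rightarrow> bool" where
  "weakly_converges_L2 S f g \<longleftrightarrow>
     (\<forall>j. f j \<in> L2_on S) \<and> g \<in> L2_on S \<and>
     (\<forall>\<phi> \<in> L2_on S. (\<lambda>j. LINT x|lebesgue_on S. f j x * \<phi> x)
        \<longlonglongrightarrow> (LINT x|lebesgue_on S. g x * \<phi> x))"

text \<open>The energy takes values in \<open>[0,\<infinity>]\<close>. The coercion \<open>ennreal\<close> truncates negative numbers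
  to \<open>0\<close>, which is harmless here because \<open>\<rho> \<ge> 0\<close> and \<open>a > 0\<close> almost everywhere.\<close>

definition energy ::
  "(real ^ 'n \<Rightarrow> real) \<Rightarrow> (real ^ 'n \<Rightarrow> real) \<Rightarrow> real \<Rightarrow> real \<Rightarrow> (real ^ 'n \<Rightarrow> real) \<Rightarrow> ennreal" where
  "energy \<rho> a T l u =
     (\<integral>\<^sup>+\<xi>\<in>ball 0 T. ennreal (\<rho> \<xi>) *
        (\<integral>\<^sup>+x\<in>unit_cube. ennreal (a x * \<bar>(u (x + l *\<^sub>R \<xi>) - u x) / l\<bar>\<^sup>2) \<partial>lebesgue) \<partial>lebesgue)"

end

theory Submission
  imports Defs
begin

text \<open>Dividing \<open>v\<^sub>j\<close> by \<open>\<lambda>\<^sub>j\<close> and subtracting the mean gives periodic functions \<open>w\<^sub>j\<close> of mean zero with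
  \<open>V\<^sub>j (x, \<xi>) = w\<^sub>j (x + \<xi>) - w\<^sub>j x\<close>; testing the weak convergence with functions of \<open>x\<close> alone shows
  that \<open>w\<^sub>j\<close> tends weakly to \<open>0\<close>. In the Euler--Lagrange equation
  \<open>\<integral>\<integral> \<rho>(\<xi>) a(x) (M \<bullet> \<xi> + w\<^sub>j (x + \<lambda>\<^sub>j \<xi>) - w\<^sub>j x) (\<phi> (x + \<lambda>\<^sub>j \<xi>) - \<phi> x) dx d\<xi> = 0\<close>
  translate the \<open>x\<close> variable so that \<open>w\<^sub>j\<close> is always evaluated at \<open>x\<close>. The remaining integrals over \<open>\<xi>\<close>
  contain a bounded periodic function evaluated at \<open>x \<plusminus> \<lambda>\<^sub>j \<xi>\<close>, and converge to constants uniformly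
  in \<open>x\<close>. As \<open>w\<^sub>j\<close> is bounded in \<open>L\<^sup>1\<close>, all terms with \<open>w\<^sub>j\<close> vanish in the limit, and \<open>\<phi> = a\<close> leaves
  the product of \<open>\<integral> \<rho>(\<xi>) M \<bullet> \<xi> d\<xi>\<close> with minus the variance of \<open>a\<close>, which is nonzero.\<close>

section \<open>Periodic functions and integrals over the cube\<close>

text \<open>The obstacle is a product of two oscillating factors: the rescaled minimizer converges
  only weakly, and for fixed \<xi> the translated coefficient does not converge strongly either, so
  their product has no evident limit. Integrating in \<xi> first removes the oscillation of the
  coefficient. This needs no smoothness of \<rho>, only continuity of translations in L1. The L1
  bound comes from minimality. Comparison with the affine function bounds the integral of
  \<rho>(\<xi>) times the squared L2 norm of the increment of the minimizer by
  \<open>l *\<^sub>R \<xi>\<close>. Since \<rho> is at least \<open>c0\<close> near 0 and a small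
  ball dilated by a large \<open>l\<close> meets many periods, this controls the increments by all
  vectors of the cube on average, and hence a function of mean zero. With the coefficient itself as
  test function the two terms with M tend to A^2 k and A2 k, where A and A2 are the means of a and
  a^2 and k is the integral sought; this is where the variance comes from. Every function is
  replaced by a Borel representative that is periodic everywhere, so that translations and Fubini
  can be applied without tracking null sets.\<close>

definition cube_frac :: "real ^ 'n \<Rightarrow> real ^ 'n" where
  "cube_frac x = (\<chi> i. frac (x $ i))"

definition int_lattice :: "(real ^ 'n) set" where
  "int_lattice = {k. \<forall>i. k $ i \<in> \<int>}"

text \<open>A density, rather than a restricted space, keeps \<open>UNIV\<close> as the space and
  \<open>borel\<close> as the sigma-algebra, so functions and their translates need no restriction.
  The total mass is 1, so integrals are means.\<close>

definition cube_measure :: "(real ^ 'n) measure" where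
  "cube_measure = density lborel (indicator unit_cube)"

text \<open>Unlike \<open>cube_periodic\<close>, this is periodicity everywhere, stated with the representative
  of \<open>x\<close> in \<open>[0,1)\<^sup>n\<close>.\<close>

definition lattice_periodic :: "(real ^ 'n \<Rightarrow> 'b) \<Rightarrow> bool" where
  "lattice_periodic f \<longleftrightarrow> (\<forall>x. f (cube_frac x) = f x)"

lemma cube_frac_nth [simp]: "cube_frac x $ i = frac (x $ i)"
  by (simp add: cube_frac_def)

lemma cube_frac_idem [simp]: "cube_frac (cube_frac x) = cube_frac x"
  by (simp add: vec_eq_iff)

lemma cube_frac_add_lattice: "k \<in> int_lattice \<Longrightarrow> cube_frac (x + k) = cube_frac x"
proof -
  assume k: "k \<in> int_lattice"
  have "frac (x $ i + k $ i) = frac (x $ i)" for i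
    using k by (auto simp: int_lattice_def frac_def elim: Ints_cases dest!: spec[of _ i])
  thus ?thesis by (simp add: vec_eq_iff)
qed

lemma diff_cube_frac_in_lattice: "x - cube_frac x \<in> int_lattice"
  by (auto simp: int_lattice_def frac_def)

lemma cube_frac_eq_self: "x \<in> unit_cube \<Longrightarrow> cube_frac x = x"
  by (auto simp: vec_eq_iff unit_cube_def frac_eq intro!: less_imp_le)

lemma lattice_periodic_add:
  "lattice_periodic f \<Longrightarrow> k \<in> int_lattice \<Longrightarrow> f (x + k) = f x"
  by (metis lattice_periodic_def cube_frac_add_lattice)

lemma lattice_periodicI:
  assumes "\<And>x k. k \<in> int_lattice \<Longrightarrow> f (x + k) = f x"
  shows "lattice_periodic f"
  unfolding lattice_periodic_def
proof
  fix x show "f (cube_frac x) = f x"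
    using assms[OF diff_cube_frac_in_lattice, of "cube_frac x" x] by simp
qed

lemma lattice_periodic_shift:
  assumes "lattice_periodic f"
  shows "lattice_periodic (\<lambda>x. f (x + y))" "lattice_periodic (\<lambda>x. f (y + x))"
proof -
  have "f (x + k + y) = f (x + y)" if "k \<in> int_lattice" for x k
    using lattice_periodic_add[OF assms that, of "x + y"] by (simp add: add_ac)
  thus "lattice_periodic (\<lambda>x. f (x + y))" by (rule lattice_periodicI)
  thus "lattice_periodic (\<lambda>x. f (y + x))" by (simp add: add.commute)
qed

text \<open>Countability is what allows sums over the lattice to be exchanged with integrals, and
  almost-everywhere statements to hold for all lattice translates at once.\<close>

lemma countable_int_lattice: "countable (int_lattice :: (real ^ 'n) set)"
proof -
  have "int_lattice \<subseteq> (\<lambda>f. (\<chi> i. real_of_int (f i)) :: real ^ 'n) ` (PiE UNIV (\<lambda>_. UNIV))"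
  proof
    fix k :: "real ^ 'n" assume "k \<in> int_lattice"
    hence "k = (\<chi> i. real_of_int \<lfloor>k $ i\<rfloor>)"
      by (auto simp: int_lattice_def vec_eq_iff)
    thus "k \<in> (\<lambda>f. (\<chi> i. real_of_int (f i)) :: real ^ 'n) ` (PiE UNIV (\<lambda>_. UNIV))"
      by (intro image_eqI[of _ _ "\<lambda>i. \<lfloor>k $ i\<rfloor>"]) auto
  qed
  moreover have "countable ((PiE UNIV (\<lambda>_. UNIV)) :: ('n \<Rightarrow> int) set)"
    by (intro countable_PiE) auto
  ultimately show ?thesis
    using countable_image countable_subset by blast
qed

lemma unit_cube_eq_box: "unit_cube = box (0 :: real ^ 'n) 1"
  by (auto simp: unit_cube_def mem_box_cart)

lemma unit_cube_borel [measurable]: "unit_cube \<in> sets borel"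
  by (simp add: unit_cube_eq_box)

lemma emeasure_unit_cube: "emeasure lborel (unit_cube :: (real ^ 'n) set) = 1"
proof -
  have "emeasure lborel (box (0 :: real ^ 'n) 1) = (\<Prod>b\<in>Basis. (1 - 0 :: real ^ 'n) \<bullet> b)"
    by (rule emeasure_lborel_box) (auto simp: Basis_vec_def inner_axis)
  also have "(\<Prod>b\<in>Basis. (1 - 0 :: real ^ 'n) \<bullet> b) = 1"
    by (rule prod.neutral) (auto simp: Basis_vec_def inner_axis)
  finally show ?thesis by (simp add: unit_cube_eq_box)
qed

text \<open>The excluded points are exactly those that no lattice translate of the open cube
  contains; they lie on countably many hyperplanes.\<close>

lemma AE_coords_nonint: "AE x in lborel. \<forall>i. (x :: real ^ 'n) $ i \<notin> \<int>"
proof -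
  have "AE x in lborel. (x :: real ^ 'n) $ i \<noteq> of_int m" for i and m :: int
  proof -
    have "negligible {x :: real ^ 'n. x \<bullet> axis i 1 = of_int m}"
      by (rule negligible_standard_hyperplane) (auto simp: Basis_vec_def)
    hence "AE x in lebesgue. (x :: real ^ 'n) \<notin> {x. x \<bullet> axis i 1 = of_int m}"
      unfolding negligible_iff_null_sets by (rule AE_not_in)
    thus ?thesis
      unfolding AE_completion_iff by (auto simp: inner_axis)
  qed
  hence "AE x in lborel. \<forall>m. (x :: real ^ 'n) $ i \<noteq> of_int m" for i
    unfolding AE_all_countable by blast
  hence "AE x in lborel. (x :: real ^ 'n) $ i \<notin> \<int>" for i
    by (rule AE_mp) (auto elim!: Ints_cases)
  thus ?thesis
    by (subst AE_all_countable) auto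
qed

lemma cube_frac_measurable [measurable]: "cube_frac \<in> borel \<rightarrow>\<^sub>M borel"
proof (subst borel_measurable_euclidean_space, rule ballI)
  fix b :: "real ^ 'n" assume "b \<in> Basis"
  then obtain i where b: "b = axis i 1" by (auto simp: Basis_vec_def)
  have "(\<lambda>x :: real ^ 'n. x $ i) \<in> borel_measurable borel"
    by (intro borel_measurable_continuous_onI continuous_intros)
  hence "(\<lambda>x :: real ^ 'n. x $ i - of_int \<lfloor>x $ i\<rfloor>) \<in> borel_measurable borel"
    by measurable
  thus "(\<lambda>x :: real ^ 'n. cube_frac x \<bullet> b) \<in> borel_measurable borel"
    by (simp add: b inner_axis frac_def)
qed

section \<open>Translations of Lebesgue measure and the tiling by the cube\<close>

lemma AE_lborel_shift:
  assumes "AE x in lborel. P x"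
  shows "AE x in lborel. P ((x :: 'a :: euclidean_space) + y)"
proof -
  \<comment> \<open>The exceptional set of \<open>P\<close> need not be Borel, so the change of
    variables is applied to a Borel null set containing it.\<close>
  obtain N where N: "{x. \<not> P x} \<subseteq> N" "N \<in> sets lborel" "emeasure lborel N = 0"
    using assms by (auto elim!: AE_E)
  have "AE x in distr lborel borel ((+) y). P x"
    by (subst lborel_distr_plus) (rule assms)
  moreover have "AE x in distr lborel borel ((+) y). x \<notin> N"
    using N by (subst lborel_distr_plus) (intro AE_not_in, auto)
  hence "AE x in lborel. y + x \<notin> N"
    using N by (subst (asm) AE_distr_iff) auto
  thus ?thesis
    by (rule AE_mp) (use N in \<open>auto simp: add.commute intro!: AE_I2\<close>)
qed

lemma nn_integral_lborel_shift:
  fixes f :: "'a :: euclidean_space \<Rightarrow> ennreal"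
  assumes [measurable]: "f \<in> borel_measurable borel"
  shows "(\<integral>\<^sup>+x. f (x + y) \<partial>lborel) = (\<integral>\<^sup>+x. f x \<partial>lborel)"
proof -
  have "(\<integral>\<^sup>+x. f x \<partial>lborel) = (\<integral>\<^sup>+x. f x \<partial>distr lborel borel ((+) y))"
    by (simp add: lborel_distr_plus)
  also have "\<dots> = (\<integral>\<^sup>+x. f (y + x) \<partial>lborel)"
    by (rule nn_integral_distr) auto
  finally show ?thesis by (simp add: add.commute)
qed

text \<open>Only one lattice vector moves \<open>x\<close> into the open cube, namely
  \<open>cube_frac x - x\<close>; the hypothesis ensures that it reaches the interior and not a
  face.\<close>

lemma sum_lattice_indicator:
  assumes "\<forall>i. (x :: real ^ 'n) $ i \<notin> \<int>"
  shows "(\<integral>\<^sup>+k. indicator unit_cube (x + k) \<partial>count_space int_lattice) = (1 :: ennreal)"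
proof -
  define k0 where "k0 = cube_frac x - x"
  have k0: "k0 \<in> int_lattice"
    by (auto simp: k0_def int_lattice_def frac_def)
  have "indicator unit_cube (x + k) = (indicator {k0} k :: ennreal)" if "k \<in> int_lattice" for k
  proof (cases "k = k0")
    case True
    have "cube_frac x \<in> unit_cube"
      using assms by (auto simp: unit_cube_def frac_gt_0_iff frac_lt_1)
    thus ?thesis using True by (simp add: k0_def)
  next
    case False
    have "x + k \<notin> unit_cube"
    proof
      assume "x + k \<in> unit_cube"
      hence "x + k = cube_frac (x + k)" by (simp add: cube_frac_eq_self)
      also have "\<dots> = cube_frac x" using that by (rule cube_frac_add_lattice)
      finally show False using False by (simp add: k0_def algebra_simps)
    qed
    thus ?thesis using False by simp
  qed
  hence "(\<integral>\<^sup>+k. indicator unit_cube (x + k) \<partial>count_space int_lattice)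
      = (\<integral>\<^sup>+k. indicator {k0} k \<partial>count_space int_lattice)"
    by (intro nn_integral_cong) auto
  also have "\<dots> = 1"
    using k0 by (subst nn_integral_indicator) auto
  finally show ?thesis .
qed

section \<open>Integration over the cube\<close>

lemma sets_cube_measure [measurable_cong, simp]: "sets cube_measure = sets borel"
  by (simp add: cube_measure_def)

lemma space_cube_measure [simp]: "space cube_measure = UNIV"
  by (simp add: cube_measure_def)

lemma nn_integral_cube_measure:
  "f \<in> borel_measurable borel \<Longrightarrow>
    (\<integral>\<^sup>+x. f x \<partial>cube_measure) = (\<integral>\<^sup>+x. indicator unit_cube x * f x \<partial>lborel)"
  unfolding cube_measure_def by (subst nn_integral_density) auto

lemma emeasure_cube_measure_space: "emeasure cube_measure UNIV = 1"
  unfolding cube_measure_def using emeasure_unit_cube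
  by (subst emeasure_density) (auto simp: mult.commute)

interpretation cube_measure: finite_measure cube_measure
  by standard (simp add: emeasure_cube_measure_space)

lemma AE_cube_measure: "AE x in lborel. P x \<Longrightarrow> AE x in cube_measure. P x"
  unfolding cube_measure_def by (subst AE_density) auto

text \<open>The translates of the cube tile the space up to a null set.\<close>

lemma nn_integral_lborel_unfold:
  fixes f :: "real ^ 'n \<Rightarrow> ennreal"
  assumes [measurable]: "f \<in> borel_measurable borel"
  shows "(\<integral>\<^sup>+x. f x \<partial>lborel) = (\<integral>\<^sup>+x. (\<integral>\<^sup>+k. f (x + k) \<partial>count_space int_lattice) \<partial>cube_measure)"
proof -
  have "(\<integral>\<^sup>+x. (\<integral>\<^sup>+k. f (x + k) \<partial>count_space int_lattice) \<partial>cube_measure)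
      = (\<integral>\<^sup>+k. (\<integral>\<^sup>+x. f (x + k) \<partial>cube_measure) \<partial>count_space int_lattice)"
    by (rule nn_integral_count_space_nn_integral[OF countable_int_lattice]) measurable
  also have "\<dots> = (\<integral>\<^sup>+k. (\<integral>\<^sup>+x. indicator unit_cube (x - k) * f x \<partial>lborel) \<partial>count_space int_lattice)"
  proof (rule nn_integral_cong)
    fix k :: "real ^ 'n"
    have "(\<integral>\<^sup>+x. f (x + k) \<partial>cube_measure) = (\<integral>\<^sup>+x. indicator unit_cube (x + k - k) * f (x + k) \<partial>lborel)"
      by (simp add: nn_integral_cube_measure)
    also have "\<dots> = (\<integral>\<^sup>+x. indicator unit_cube (x - k) * f x \<partial>lborel)"
      by (rule nn_integral_lborel_shift) measurable
    finally show "(\<integral>\<^sup>+x. f (x + k) \<partial>cube_measure) = \<dots>" .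
  qed
  also have "\<dots> = (\<integral>\<^sup>+x. (\<integral>\<^sup>+k. indicator unit_cube (x - k) * f x \<partial>count_space int_lattice) \<partial>lborel)"
    by (rule nn_integral_count_space_nn_integral[OF countable_int_lattice, symmetric]) measurable
  also have "\<dots> = (\<integral>\<^sup>+x. f x \<partial>lborel)"
  proof (rule nn_integral_cong_AE, rule AE_mp[OF AE_coords_nonint], intro AE_I2 impI)
    fix x :: "real ^ 'n" assume x: "\<forall>i. x $ i \<notin> \<int>"
    have bij: "bij_betw uminus int_lattice (int_lattice :: (real ^ 'n) set)"
      by (intro bij_betwI[of _ _ _ uminus]) (auto simp: int_lattice_def)
    have "(\<integral>\<^sup>+k. indicator unit_cube (x - k) \<partial>count_space int_lattice)
        = (\<integral>\<^sup>+k. indicator unit_cube (x + k) \<partial>count_space int_lattice :: ennreal)"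
      using nn_integral_bij_count_space[OF bij, of "\<lambda>k. indicator unit_cube (x + k)"] by simp
    thus "(\<integral>\<^sup>+k. indicator unit_cube (x - k) * f x \<partial>count_space int_lattice) = f x"
      by (simp add: nn_integral_multc sum_lattice_indicator[OF x])
  qed
  finally show ?thesis ..
qed

text \<open>Unfold the indicator of the exceptional set: by periodicity all its lattice translates
  vanish at a point where \<open>P\<close> holds, so the sum under the integral is 0 almost
  everywhere.\<close>

lemma AE_lborel_if_AE_cube:
  fixes P :: "real ^ 'n \<Rightarrow> bool"
  assumes P: "lattice_periodic P" and [measurable]: "Measurable.pred borel P"
  assumes AE: "AE x in cube_measure. P x"
  shows "AE x in lborel. P x"
proof -
  have "(\<integral>\<^sup>+x. indicator {x. \<not> P x} x \<partial>lborel)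
      = (\<integral>\<^sup>+x. (\<integral>\<^sup>+k. indicator {x. \<not> P x} (x + k) \<partial>count_space int_lattice) \<partial>cube_measure)"
    by (rule nn_integral_lborel_unfold) measurable
  also have "\<dots> = (\<integral>\<^sup>+x. 0 \<partial>(cube_measure :: (real ^ 'n) measure))"
  proof (rule nn_integral_cong_AE, rule AE_mp[OF AE], intro AE_I2 impI)
    fix x assume "P x"
    have "(\<integral>\<^sup>+k. indicator {x. \<not> P x} (x + k) \<partial>count_space int_lattice)
        = (\<integral>\<^sup>+k. 0 \<partial>count_space (int_lattice :: (real ^ 'n) set))"
      using \<open>P x\<close> by (intro nn_integral_cong) (auto simp: lattice_periodic_add[OF P])
    thus "(\<integral>\<^sup>+k. indicator {x. \<not> P x} (x + k) \<partial>count_space int_lattice) = 0" by simp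
  qed
  finally show ?thesis
    by (subst AE_iff_measurable[OF _ refl]) auto
qed

text \<open>The cube shifted by \<open>y\<close> is a fundamental domain too. Unfolding the integral
  over it lets \<open>f\<close> leave the sum by periodicity, and the indicators sum to 1 wherever
  \<open>x - y\<close> has no integer coordinate.\<close>

lemma nn_integral_cube_shift:
  fixes f :: "real ^ 'n \<Rightarrow> ennreal"
  assumes f: "lattice_periodic f" and [measurable]: "f \<in> borel_measurable borel"
  shows "(\<integral>\<^sup>+x. f (x + y) \<partial>cube_measure) = (\<integral>\<^sup>+x. f x \<partial>cube_measure)"
proof -
  have "(\<integral>\<^sup>+x. f (x + y) \<partial>cube_measure) = (\<integral>\<^sup>+x. indicator unit_cube (x + y - y) * f (x + y) \<partial>lborel)"
    by (simp add: nn_integral_cube_measure)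
  also have "\<dots> = (\<integral>\<^sup>+x. indicator unit_cube (x - y) * f x \<partial>lborel)"
    by (rule nn_integral_lborel_shift) measurable
  also have "\<dots> = (\<integral>\<^sup>+x. (\<integral>\<^sup>+k. indicator unit_cube (x + k - y) * f (x + k)
      \<partial>count_space int_lattice) \<partial>cube_measure)"
    by (rule nn_integral_lborel_unfold) measurable
  also have "\<dots> = (\<integral>\<^sup>+x. f x \<partial>cube_measure)"
  proof (rule nn_integral_cong_AE, rule AE_mp[OF AE_cube_measure[OF AE_lborel_shift[OF AE_coords_nonint, of "- y"]]],
      intro AE_I2 impI)
    fix x assume x: "\<forall>i. (x + - y) $ i \<notin> \<int>"
    have "(\<integral>\<^sup>+k. indicator unit_cube (x + k - y) * f (x + k) \<partial>count_space int_lattice)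
        = (\<integral>\<^sup>+k. indicator unit_cube (x + - y + k) * f x \<partial>count_space int_lattice)"
      by (intro nn_integral_cong) (simp add: lattice_periodic_add[OF f] diff_add_eq)
    also have "\<dots> = f x"
      using sum_lattice_indicator[OF x] by (subst nn_integral_multc) simp_all
    finally show "(\<integral>\<^sup>+k. indicator unit_cube (x + k - y) * f (x + k) \<partial>count_space int_lattice) = f x" .
  qed
  finally show ?thesis .
qed

text \<open>This is translation invariance on the torus, as an equality of measures. In this form it
  yields at once both the value and the integrability of real integrals, with no splitting into
  positive and negative parts.\<close>

lemma distr_cube_shift:
  "distr cube_measure borel (\<lambda>x. cube_frac (x + y)) = distr cube_measure borel (cube_frac :: real ^ 'n \<Rightarrow> _)"
proof (rule measure_eqI)
  fix A assume "A \<in> sets (distr cube_measure borel (\<lambda>x. cube_frac (x + y)))"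
  hence [measurable]: "A \<in> sets borel" by simp
  have "emeasure (distr cube_measure borel (\<lambda>x. cube_frac (x + y))) A
      = (\<integral>\<^sup>+x. indicator A (cube_frac (x + y)) \<partial>cube_measure)"
    by (subst nn_integral_indicator[symmetric]) (auto simp del: nn_integral_indicator simp add: nn_integral_distr)
  also have "\<dots> = (\<integral>\<^sup>+x. indicator A (cube_frac x) \<partial>cube_measure)"
    by (rule nn_integral_cube_shift) (auto simp: lattice_periodic_def)
  also have "\<dots> = emeasure (distr cube_measure borel cube_frac) A"
    by (subst nn_integral_indicator[symmetric]) (auto simp del: nn_integral_indicator simp add: nn_integral_distr)
  finally show "emeasure (distr cube_measure borel (\<lambda>x. cube_frac (x + y))) A = \<dots>" .
qed simp

lemma
  fixes f :: "real ^ 'n \<Rightarrow> real"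
  assumes f: "lattice_periodic f" and [measurable]: "f \<in> borel_measurable borel"
  shows integral_cube_shift: "(\<integral>x. f (x + y) \<partial>cube_measure) = (\<integral>x. f x \<partial>cube_measure)"
    and integrable_cube_shift: "integrable cube_measure (\<lambda>x. f (x + y)) \<longleftrightarrow> integrable cube_measure f"
proof -
  have eq: "f (cube_frac x) = f x" for x using f by (simp add: lattice_periodic_def)
  have "(\<integral>x. f (x + y) \<partial>cube_measure) = (\<integral>x. f x \<partial>distr cube_measure borel (\<lambda>x. cube_frac (x + y)))"
    by (subst integral_distr) (auto simp: eq)
  also have "\<dots> = (\<integral>x. f x \<partial>cube_measure)"
    unfolding distr_cube_shift by (subst integral_distr) (auto simp: eq)
  finally show "(\<integral>x. f (x + y) \<partial>cube_measure) = (\<integral>x. f x \<partial>cube_measure)" .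
  have "integrable cube_measure (\<lambda>x. f (x + y)) \<longleftrightarrow>
      integrable (distr cube_measure borel (\<lambda>x. cube_frac (x + y))) f"
    by (subst integrable_distr_eq) (auto simp: eq)
  also have "\<dots> \<longleftrightarrow> integrable cube_measure f"
    unfolding distr_cube_shift by (subst integrable_distr_eq) (auto simp: eq)
  finally show "integrable cube_measure (\<lambda>x. f (x + y)) \<longleftrightarrow> integrable cube_measure f" .
qed

section \<open>Continuity of translations in \<open>L\<^sup>1\<close>\<close>

lemma integral_lborel_shift:
  fixes f :: "'a :: euclidean_space \<Rightarrow> real"
  assumes [measurable]: "f \<in> borel_measurable borel"
  shows "(\<integral>x. f (x + y) \<partial>lborel) = (\<integral>x. f x \<partial>lborel)"
proof -
  have "(\<integral>x. f x \<partial>lborel) = (\<integral>x. f x \<partial>distr lborel borel ((+) y))"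
    by (simp add: lborel_distr_plus)
  also have "\<dots> = (\<integral>x. f (y + x) \<partial>lborel)"
    by (rule integral_distr) auto
  finally show ?thesis by (simp add: add.commute)
qed

lemma integrable_lborel_shift:
  fixes f :: "'a :: euclidean_space \<Rightarrow> real"
  assumes f: "integrable lborel f"
  shows "integrable lborel (\<lambda>x. f (x + y))"
proof -
  have [measurable]: "f \<in> borel_measurable borel"
    using borel_measurable_integrable[OF f] by simp
  have "integrable (distr lborel borel ((+) y)) f" by (simp add: lborel_distr_plus f)
  hence "integrable lborel (\<lambda>x. f (y + x))" by (subst (asm) integrable_distr_eq) auto
  thus ?thesis by (simp add: add.commute)
qed

text \<open>Triangle inequality; the distance of \<sigma> and \<tau> counts twice, once in place and
  once translated. The case \<tau> = 0 later bounds the modulus of continuity by twice the L1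
  norm.\<close>

lemma L1_shift_bound:
  fixes \<sigma> \<tau> :: "'a :: euclidean_space \<Rightarrow> real"
  assumes \<sigma>: "integrable lborel \<sigma>" and \<tau>: "integrable lborel \<tau>"
  shows "(\<integral>x. \<bar>\<sigma> x - \<sigma> (x + t)\<bar> \<partial>lborel)
           \<le> (\<integral>x. \<bar>\<tau> x - \<tau> (x + t)\<bar> \<partial>lborel) + 2 * (\<integral>x. \<bar>\<sigma> x - \<tau> x\<bar> \<partial>lborel)"
proof -
  note [simp] = \<sigma> \<tau> integrable_lborel_shift
  have diff: "integrable lborel (\<lambda>x. \<bar>\<sigma> x - \<tau> x\<bar>)" by simp
  have "(\<integral>x. \<bar>\<sigma> x - \<sigma> (x + t)\<bar> \<partial>lborel)
      \<le> (\<integral>x. \<bar>\<tau> x - \<tau> (x + t)\<bar> + \<bar>\<sigma> x - \<tau> x\<bar> + \<bar>\<sigma> (x + t) - \<tau> (x + t)\<bar> \<partial>lborel)"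
    by (rule integral_mono) auto
  also have "\<dots> = (\<integral>x. \<bar>\<tau> x - \<tau> (x + t)\<bar> \<partial>lborel) + (\<integral>x. \<bar>\<sigma> x - \<tau> x\<bar> \<partial>lborel)
      + (\<integral>x. \<bar>\<sigma> (x + t) - \<tau> (x + t)\<bar> \<partial>lborel)"
    by (simp add: integrable_lborel_shift[OF diff])
  also have "(\<integral>x. \<bar>\<sigma> (x + t) - \<tau> (x + t)\<bar> \<partial>lborel) = (\<integral>x. \<bar>\<sigma> x - \<tau> x\<bar> \<partial>lborel)"
    by (rule integral_lborel_shift) (use borel_measurable_integrable[OF diff] in simp)
  finally show ?thesis by simp
qed

text \<open>The functions with the desired property are closed in L1, uniformly in the translation:
  an approximation within \<open>e / 4\<close> costs \<open>e / 2\<close>, and the approximant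
  contributes the rest.\<close>

lemma L1_shift_tendsto_approx:
  fixes \<sigma> :: "'a :: euclidean_space \<Rightarrow> real" and t :: "nat \<Rightarrow> 'a"
  assumes \<sigma>: "integrable lborel \<sigma>"
  assumes approx: "\<And>e. e > 0 \<Longrightarrow> \<exists>\<tau>. integrable lborel \<tau> \<and> (\<integral>x. \<bar>\<sigma> x - \<tau> x\<bar> \<partial>lborel) < e \<and>
     (\<lambda>n. \<integral>x. \<bar>\<tau> x - \<tau> (x + t n)\<bar> \<partial>lborel) \<longlonglongrightarrow> 0"
  shows "(\<lambda>n. \<integral>x. \<bar>\<sigma> x - \<sigma> (x + t n)\<bar> \<partial>lborel) \<longlonglongrightarrow> 0"
proof (rule tendstoI)
  fix e :: real assume "e > 0"
  then obtain \<tau> where \<tau>: "integrable lborel \<tau>" "(\<integral>x. \<bar>\<sigma> x - \<tau> x\<bar> \<partial>lborel) < e / 4"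
     and lim: "(\<lambda>n. \<integral>x. \<bar>\<tau> x - \<tau> (x + t n)\<bar> \<partial>lborel) \<longlonglongrightarrow> 0"
    using approx[of "e / 4"] by auto
  have "eventually (\<lambda>n. dist (\<integral>x. \<bar>\<tau> x - \<tau> (x + t n)\<bar> \<partial>lborel) 0 < e / 2) sequentially"
    using lim \<open>e > 0\<close> by (intro tendstoD) auto
  thus "eventually (\<lambda>n. dist (\<integral>x. \<bar>\<sigma> x - \<sigma> (x + t n)\<bar> \<partial>lborel) 0 < e) sequentially"
  proof eventually_elim
    case (elim n)
    have "0 \<le> (\<integral>x. \<bar>\<sigma> x - \<sigma> (x + t n)\<bar> \<partial>lborel)" by simp
    thus ?case using elim \<tau>(2) L1_shift_bound[OF \<sigma> \<tau>(1), of "t n"] by (simp add: dist_real_def)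
  qed
qed

text \<open>The translated indicators need not converge pointwise on the boundary of
  \<open>U\<close>, which may have positive measure. For p, q in {0, 1} one has |p - q| = p + q - 2
  p q, so it is enough to treat the product, which vanishes off \<open>U\<close>; and a point of the
  open set \<open>U\<close> stays in it under small translations.\<close>

lemma L1_shift_tendsto_open:
  fixes t :: "nat \<Rightarrow> 'a :: euclidean_space"
  assumes t: "t \<longlonglongrightarrow> 0" and U: "open U" "emeasure lborel U < \<infinity>"
  shows "(\<lambda>n. \<integral>x. \<bar>indicator U x - indicator U (x + t n)\<bar> \<partial>lborel) \<longlonglongrightarrow> (0 :: real)"
proof -
  let ?i = "indicator U :: 'a \<Rightarrow> real"
  have [measurable]: "U \<in> sets borel" using U by simp
  have int: "integrable lborel ?i" using U by simp
  have int_shift: "integrable lborel (\<lambda>x. ?i (x + s))" for s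
    by (rule integrable_lborel_shift[OF int])
  have int_mult: "integrable lborel (\<lambda>x. ?i x * ?i (x + s))" for s
    by (rule Bochner_Integration.integrable_bound[OF int]) (auto simp: indicator_def)
  have "(\<lambda>n. \<integral>x. ?i x * ?i (x + t n) \<partial>lborel) \<longlonglongrightarrow> (\<integral>x. ?i x \<partial>lborel)"
  proof (rule integral_dominated_convergence[OF _ _ int])
    show "AE x in lborel. (\<lambda>n. ?i x * ?i (x + t n)) \<longlonglongrightarrow> ?i x"
    proof (rule AE_I2)
      fix x
      show "(\<lambda>n. ?i x * ?i (x + t n)) \<longlonglongrightarrow> ?i x"
      proof (cases "x \<in> U")
        case True
        have "(\<lambda>n. x + t n) \<longlonglongrightarrow> x + 0" by (intro tendsto_intros t)
        hence "eventually (\<lambda>n. x + t n \<in> U) sequentially"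
          using U True by (intro topological_tendstoD) auto
        hence "eventually (\<lambda>n. ?i x * ?i (x + t n) = ?i x) sequentially"
          by eventually_elim (use True in auto)
        thus ?thesis by (rule tendsto_eventually)
      qed auto
    qed
  qed (auto simp: indicator_def)
  hence "(\<lambda>n. 2 * ((\<integral>x. ?i x \<partial>lborel) - (\<integral>x. ?i x * ?i (x + t n) \<partial>lborel))) \<longlonglongrightarrow>
      2 * ((\<integral>x. ?i x \<partial>lborel) - (\<integral>x. ?i x \<partial>lborel))"
    by (intro tendsto_intros)
  moreover have "(\<integral>x. \<bar>?i x - ?i (x + s)\<bar> \<partial>lborel)
      = 2 * ((\<integral>x. ?i x \<partial>lborel) - (\<integral>x. ?i x * ?i (x + s) \<partial>lborel))" for s
  proof -
    have "(\<integral>x. \<bar>?i x - ?i (x + s)\<bar> \<partial>lborel) = (\<integral>x. ?i x + ?i (x + s) - 2 * (?i x * ?i (x + s)) \<partial>lborel)"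
      by (rule Bochner_Integration.integral_cong) (auto simp: indicator_def)
    also have "\<dots> = (\<integral>x. ?i x \<partial>lborel) + (\<integral>x. ?i (x + s) \<partial>lborel) - 2 * (\<integral>x. ?i x * ?i (x + s) \<partial>lborel)"
      using int int_shift[of s] int_mult[of s] by simp
    finally show ?thesis using integral_lborel_shift[of ?i s] by simp
  qed
  ultimately show ?thesis by simp
qed

text \<open>Indicators of measurable sets are approximated from outside by those of open sets.\<close>

lemma L1_shift_tendsto:
  fixes \<sigma> :: "'a :: euclidean_space \<Rightarrow> real" and t :: "nat \<Rightarrow> 'a"
  assumes \<sigma>: "integrable lborel \<sigma>" and t: "t \<longlonglongrightarrow> 0"
  shows "(\<lambda>n. \<integral>x. \<bar>\<sigma> x - \<sigma> (x + t n)\<bar> \<partial>lborel) \<longlonglongrightarrow> 0"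
  using \<sigma>
proof (induction rule: integrable_induct)
  case (base A c)
  have [measurable]: "A \<in> sets borel" using base by simp
  have "(\<lambda>n. \<integral>x. \<bar>indicator A x - indicator A (x + t n)\<bar> \<partial>lborel) \<longlonglongrightarrow> (0 :: real)"
  proof (rule L1_shift_tendsto_approx)
    show "integrable lborel (indicator A :: 'a \<Rightarrow> real)" using base by simp
    fix e :: real assume "e > 0"
    moreover have "A \<in> sets lebesgue" by simp
    ultimately obtain U where U: "open U" "A \<subseteq> U" "emeasure lebesgue (U - A) < ennreal e"
      using sets_lebesgue_outer_open by metis
    have [measurable]: "U \<in> sets borel" using U by simp
    have UA: "emeasure lborel (U - A) < ennreal e" using U by simp
    have "emeasure lborel U = emeasure lborel A + emeasure lborel (U - A)"
      using U(2) by (subst plus_emeasure) (auto intro!: arg_cong[of _ _ "emeasure lborel"])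
    also have "\<dots> < \<infinity>" using base less_trans[OF UA ennreal_less_top] by simp
    finally have fin: "emeasure lborel U < \<infinity>" .
    have "(\<integral>x. \<bar>indicator A x - indicator U x\<bar> \<partial>lborel) = (\<integral>x. indicator (U - A) x \<partial>lborel :: real)"
      using U(2) by (intro Bochner_Integration.integral_cong) (auto simp: indicator_def)
    also have "\<dots> = measure lborel (U - A)" by simp
    also have "\<dots> < e" using UA \<open>e > 0\<close>
      using less_trans[OF UA ennreal_less_top]
      by (subst (asm) emeasure_eq_ennreal_measure) (auto simp: ennreal_less_iff)
    finally show "\<exists>\<tau>. integrable lborel \<tau> \<and> (\<integral>x. \<bar>indicator A x - \<tau> x\<bar> \<partial>lborel) < e \<and>
        (\<lambda>n. \<integral>x. \<bar>\<tau> x - \<tau> (x + t n)\<bar> \<partial>lborel) \<longlonglongrightarrow> 0"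
      using L1_shift_tendsto_open[OF t U(1) fin] fin by (intro exI[of _ "indicator U"]) auto
  qed
  hence "(\<lambda>n. \<bar>c\<bar> * (\<integral>x. \<bar>indicator A x - indicator A (x + t n)\<bar> \<partial>lborel)) \<longlonglongrightarrow> \<bar>c\<bar> * 0"
    by (intro tendsto_intros)
  moreover have "(\<integral>x. \<bar>indicator A x *\<^sub>R c - indicator A (x + s) *\<^sub>R c\<bar> \<partial>lborel)
      = \<bar>c\<bar> * (\<integral>x. \<bar>indicator A x - indicator A (x + s)\<bar> \<partial>lborel)" for s
    by (subst integral_mult_right_zero[symmetric])
       (auto simp: abs_mult[symmetric] algebra_simps intro!: Bochner_Integration.integral_cong)
  ultimately show ?case by simp
next
  case (add f g)
  show ?case
  proof (rule tendsto_sandwich[OF _ _ tendsto_const])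
    show "(\<lambda>n. (\<integral>x. \<bar>f x - f (x + t n)\<bar> \<partial>lborel) + (\<integral>x. \<bar>g x - g (x + t n)\<bar> \<partial>lborel)) \<longlonglongrightarrow> 0"
      using tendsto_add[OF add.IH] by simp
    show "\<forall>\<^sub>F n in sequentially. (\<integral>x. \<bar>f x + g x - (f (x + t n) + g (x + t n))\<bar> \<partial>lborel)
       \<le> (\<integral>x. \<bar>f x - f (x + t n)\<bar> \<partial>lborel) + (\<integral>x. \<bar>g x - g (x + t n)\<bar> \<partial>lborel)"
    proof (rule always_eventually, rule allI)
      fix n
      show "(\<integral>x. \<bar>f x + g x - (f (x + t n) + g (x + t n))\<bar> \<partial>lborel)
       \<le> (\<integral>x. \<bar>f x - f (x + t n)\<bar> \<partial>lborel) + (\<integral>x. \<bar>g x - g (x + t n)\<bar> \<partial>lborel)"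
      proof -
        have int: "integrable lborel (\<lambda>x. \<bar>f x - f (x + t n)\<bar>)" "integrable lborel (\<lambda>x. \<bar>g x - g (x + t n)\<bar>)"
          using add.hyps add.hyps[THEN integrable_lborel_shift, of "t n"] by auto
        show ?thesis
          unfolding Bochner_Integration.integral_add[OF int, symmetric]
          using add.hyps add.hyps[THEN integrable_lborel_shift, of "t n"] by (intro integral_mono) auto
      qed
    qed
  qed auto
next
  case (lim f s)
  show ?case
  proof (rule L1_shift_tendsto_approx[OF lim.hyps(4)])
    fix e :: real assume "e > 0"
    have [measurable]: "f \<in> borel_measurable borel" "s i \<in> borel_measurable borel" for i
      using borel_measurable_integrable[OF lim.hyps(4)] borel_measurable_integrable[OF lim.hyps(1)] by simp_all
    have "(\<lambda>i. \<integral>x. \<bar>f x - s i x\<bar> \<partial>lborel) \<longlonglongrightarrow> (\<integral>x. (0 :: real) \<partial>(lborel :: 'a measure))"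
    \<comment> \<open>The approximants of the induction rule satisfy |s i x| \<le> 2 |f x|, hence
      the factor 3.\<close>
    proof (rule integral_dominated_convergence[where w = "\<lambda>x. 3 * \<bar>f x\<bar>"])
      show "AE x in lborel. (\<lambda>i. \<bar>f x - s i x\<bar>) \<longlonglongrightarrow> 0"
      proof (rule AE_I2)
        fix x
        have "(\<lambda>i. \<bar>f x - s i x\<bar>) \<longlonglongrightarrow> \<bar>f x - f x\<bar>"
          by (intro tendsto_intros lim.hyps(2)) auto
        thus "(\<lambda>i. \<bar>f x - s i x\<bar>) \<longlonglongrightarrow> 0" by simp
      qed
      show "AE x in lborel. norm \<bar>f x - s i x\<bar> \<le> 3 * \<bar>f x\<bar>" for i
        using lim.hyps(3)[of _ i] by (intro AE_I2) (auto intro: order_trans[OF abs_triangle_ineq4])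
    qed (use lim.hyps(4) in auto)
    hence "eventually (\<lambda>i. dist (\<integral>x. \<bar>f x - s i x\<bar> \<partial>lborel) 0 < e) sequentially"
      using \<open>e > 0\<close> by (intro tendstoD) auto
    then obtain i where "(\<integral>x. \<bar>f x - s i x\<bar> \<partial>lborel) < e"
      by (auto simp: eventually_sequentially dist_real_def)
    thus "\<exists>\<tau>. integrable lborel \<tau> \<and> (\<integral>x. \<bar>f x - \<tau> x\<bar> \<partial>lborel) < e \<and>
        (\<lambda>n. \<integral>x. \<bar>\<tau> x - \<tau> (x + t n)\<bar> \<partial>lborel) \<longlonglongrightarrow> 0"
      using lim by blast
  qed
qed

section \<open>Averaging of oscillating periodic functions\<close>

lemma integrable_cube_bounded:
  fixes f :: "real ^ 'n \<Rightarrow> real"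
  assumes [measurable]: "f \<in> borel_measurable borel" and "\<And>x. \<bar>f x\<bar> \<le> B"
  shows "integrable cube_measure f"
  by (rule cube_measure.integrable_const_bound[of _ B]) (use assms in auto)

lemma measure_cube_UNIV: "measure cube_measure UNIV = 1"
  by (simp add: measure_def emeasure_cube_measure_space)

interpretation lborel_cube: pair_sigma_finite "lborel :: (real ^ 'm) measure" "cube_measure :: (real ^ 'n) measure" ..

text \<open>Oscillating periodic functions average out. Since the mean of \<open>f\<close> is also the mean over
  \<open>h\<close> of its translates, one may replace a translation of \<open>f\<close> by \<open>h\<close> with a translation
  of \<open>\<sigma>\<close> by \<open>- h / l\<close>, which is negligible in \<open>L\<^sup>1\<close>.\<close>

lemma averaging_error_le:
  fixes \<sigma> f :: "real ^ 'n \<Rightarrow> real"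
  assumes \<sigma>: "integrable lborel \<sigma>"
    and f: "lattice_periodic f" and [measurable]: "f \<in> borel_measurable borel" and B: "\<And>x. \<bar>f x\<bar> \<le> B"
    and l: "l \<noteq> 0"
  shows "\<bar>(\<integral>\<xi>. \<sigma> \<xi> * f (y + l *\<^sub>R \<xi>) \<partial>lborel) - (\<integral>x. f x \<partial>cube_measure) * (\<integral>\<xi>. \<sigma> \<xi> \<partial>lborel)\<bar>
    \<le> B * (\<integral>h. (\<integral>\<xi>. \<bar>\<sigma> \<xi> - \<sigma> (\<xi> + (- h /\<^sub>R l))\<bar> \<partial>lborel) \<partial>cube_measure)"
proof -
  have [measurable]: "\<sigma> \<in> borel_measurable borel"
    using borel_measurable_integrable[OF \<sigma>] by simp
  have B0: "B \<ge> 0" using B[of 0] by (rule order_trans[OF abs_ge_zero])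
  have int_bd: "integrable lborel (\<lambda>\<xi>. g \<xi> * k \<xi>)"
    if "integrable lborel g" "k \<in> borel_measurable borel" "\<And>x. \<bar>k x\<bar> \<le> B" for g k :: "real ^ 'n \<Rightarrow> real"
  proof (rule Bochner_Integration.integrable_bound[of _ "\<lambda>\<xi>. B * g \<xi>"])
    show "integrable lborel (\<lambda>\<xi>. B * g \<xi>)" using that by simp
    show "(\<lambda>\<xi>. g \<xi> * k \<xi>) \<in> borel_measurable lborel"
      using that borel_measurable_integrable[OF that(1)] by simp
    have "\<bar>g \<xi>\<bar> * \<bar>k \<xi>\<bar> \<le> \<bar>g \<xi>\<bar> * B" for \<xi>
      using that(3) by (intro mult_left_mono) auto
    thus "AE \<xi> in lborel. norm (g \<xi> * k \<xi>) \<le> norm (B * g \<xi>)"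
      using B0 by (intro AE_I2) (simp add: abs_mult mult.commute)
  qed
  define K where "K = (\<integral>\<xi>. \<sigma> \<xi> * f (y + l *\<^sub>R \<xi>) \<partial>lborel)"
  define \<omega> where "\<omega> h = (\<integral>\<xi>. \<bar>\<sigma> \<xi> - \<sigma> (\<xi> + (- h /\<^sub>R l))\<bar> \<partial>lborel)" for h
  have shift: "integrable lborel (\<lambda>\<xi>. \<sigma> (\<xi> + s))" for s
    by (rule integrable_lborel_shift[OF \<sigma>])
  have \<omega>_meas [measurable]: "\<omega> \<in> borel_measurable borel"
    unfolding \<omega>_def by measurable
  have \<omega>_bound: "\<bar>\<omega> h\<bar> \<le> 2 * (\<integral>\<xi>. \<bar>\<sigma> \<xi>\<bar> \<partial>lborel)" for h
    using L1_shift_bound[OF \<sigma>, of "\<lambda>_. 0" "- h /\<^sub>R l"] by (simp add: \<omega>_def)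
  have \<omega>_int: "integrable cube_measure \<omega>"
    using \<omega>_bound by (intro integrable_cube_bounded) auto
  \<comment> \<open>\<open>I 0\<close> is \<open>K\<close>. The substitution of \<xi> - h / l for
    \<xi> shows that each \<open>I h\<close> is close to \<open>K\<close>, while Fubini computes the
    mean of \<open>I\<close> over the cube exactly.\<close>
  define I where "I h = (\<integral>\<xi>. \<sigma> \<xi> * f (y + l *\<^sub>R \<xi> + h) \<partial>lborel)" for h
  have I_meas [measurable]: "I \<in> borel_measurable borel"
    unfolding I_def by measurable
  have I_bd: "\<bar>I h - K\<bar> \<le> B * \<omega> h" for h
  proof -
    have "I h = (\<integral>\<xi>. \<sigma> (\<xi> + (- h /\<^sub>R l)) * f (y + l *\<^sub>R (\<xi> + (- h /\<^sub>R l)) + h) \<partial>lborel)"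
      unfolding I_def by (rule integral_lborel_shift[symmetric]) measurable
    also have "\<dots> = (\<integral>\<xi>. \<sigma> (\<xi> + (- h /\<^sub>R l)) * f (y + l *\<^sub>R \<xi>) \<partial>lborel)"
      using l by (simp add: scaleR_right_distrib scaleR_diff_right)
    finally have "I h = \<dots>" .
    hence "\<bar>I h - K\<bar> = \<bar>\<integral>\<xi>. \<sigma> (\<xi> + (- h /\<^sub>R l)) * f (y + l *\<^sub>R \<xi>) - \<sigma> \<xi> * f (y + l *\<^sub>R \<xi>) \<partial>lborel\<bar>"
      unfolding K_def using int_bd[OF \<sigma>, of "\<lambda>\<xi>. f (y + l *\<^sub>R \<xi>)"]
        int_bd[OF shift[of "- h /\<^sub>R l"], of "\<lambda>\<xi>. f (y + l *\<^sub>R \<xi>)"] B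
      by (subst Bochner_Integration.integral_diff) auto
    also have "\<dots> = \<bar>\<integral>\<xi>. (\<sigma> (\<xi> + (- h /\<^sub>R l)) - \<sigma> \<xi>) * f (y + l *\<^sub>R \<xi>) \<partial>lborel\<bar>"
      by (simp add: algebra_simps)
    also have "\<dots> \<le> (\<integral>\<xi>. \<bar>(\<sigma> (\<xi> + (- h /\<^sub>R l)) - \<sigma> \<xi>) * f (y + l *\<^sub>R \<xi>)\<bar> \<partial>lborel)"
      by (rule integral_abs_bound)
    also have "\<dots> \<le> (\<integral>\<xi>. B * \<bar>\<sigma> \<xi> - \<sigma> (\<xi> + (- h /\<^sub>R l))\<bar> \<partial>lborel)"
    proof (rule integral_mono)
      show "integrable lborel (\<lambda>\<xi>. \<bar>(\<sigma> (\<xi> + (- h /\<^sub>R l)) - \<sigma> \<xi>) * f (y + l *\<^sub>R \<xi>)\<bar>)"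
        using shift[of "- h /\<^sub>R l"] \<sigma> B
        by (intro integrable_abs int_bd Bochner_Integration.integrable_diff) auto
      show "integrable lborel (\<lambda>\<xi>. B * \<bar>\<sigma> \<xi> - \<sigma> (\<xi> + (- h /\<^sub>R l))\<bar>)"
        using shift[of "- h /\<^sub>R l"] \<sigma> by simp
      show "\<bar>(\<sigma> (\<xi> + (- h /\<^sub>R l)) - \<sigma> \<xi>) * f (y + l *\<^sub>R \<xi>)\<bar> \<le> B * \<bar>\<sigma> \<xi> - \<sigma> (\<xi> + (- h /\<^sub>R l))\<bar>" for \<xi>
        unfolding abs_mult mult.commute[of B] abs_minus_commute[of "\<sigma> \<xi>"]
        using B by (intro mult_left_mono) auto
    qed
    also have "\<dots> = B * \<omega> h" by (simp add: \<omega>_def)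
    finally show ?thesis .
  qed
  have prod_int: "integrable (lborel \<Otimes>\<^sub>M cube_measure) (\<lambda>(\<xi>, h). \<sigma> \<xi> * f (y + l *\<^sub>R \<xi> + h))"
  proof (rule Bochner_Integration.integrable_bound[of _ "\<lambda>(\<xi>, h). B * \<sigma> \<xi>"])
    show "integrable (lborel \<Otimes>\<^sub>M cube_measure) (\<lambda>(\<xi>, h :: real ^ 'n). B * \<sigma> \<xi>)"
      using \<sigma> by (intro lborel_cube.Fubini_integrable) (auto simp: measure_cube_UNIV)
    have "\<bar>\<sigma> \<xi>\<bar> * \<bar>f x\<bar> \<le> \<bar>\<sigma> \<xi>\<bar> * B" for \<xi> x
      using B by (intro mult_left_mono) auto
    thus "AE p in lborel \<Otimes>\<^sub>M cube_measure. norm (case p of (\<xi>, h) \<Rightarrow> \<sigma> \<xi> * f (y + l *\<^sub>R \<xi> + h))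
       \<le> norm (case p of (\<xi>, h) \<Rightarrow> B * \<sigma> \<xi>)"
      using B0 by (intro AE_I2) (auto simp: abs_mult mult.commute)
  qed measurable
  have "(\<integral>h. I h \<partial>cube_measure) = (\<integral>\<xi>. (\<integral>h. \<sigma> \<xi> * f (y + l *\<^sub>R \<xi> + h) \<partial>cube_measure) \<partial>lborel)"
    unfolding I_def by (rule lborel_cube.Fubini_integral[OF prod_int])
  also have "\<dots> = (\<integral>\<xi>. (\<integral>x. f x \<partial>cube_measure) * \<sigma> \<xi> \<partial>lborel)"
    by (simp add: add.commute[of "y + _"] integral_cube_shift[OF f] mult.commute)
  finally have I_eq: "(\<integral>h. I h \<partial>cube_measure) = (\<integral>x. f x \<partial>cube_measure) * (\<integral>\<xi>. \<sigma> \<xi> \<partial>lborel)"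
    by simp
  have I_int: "integrable cube_measure (\<lambda>h. I h - K)"
    by (rule Bochner_Integration.integrable_bound[of _ "\<lambda>h. B * \<omega> h"])
       (use \<omega>_int I_bd in \<open>auto intro: order_trans[OF _ abs_ge_self]\<close>)
  have "integrable cube_measure (\<lambda>h. (I h - K) + K)"
    using I_int by (intro Bochner_Integration.integrable_add) auto
  hence "(\<integral>h. I h \<partial>cube_measure) - K = (\<integral>h. I h - K \<partial>cube_measure)"
    by (simp add: measure_cube_UNIV)
  hence "\<bar>K - (\<integral>h. I h \<partial>cube_measure)\<bar> = \<bar>\<integral>h. I h - K \<partial>cube_measure\<bar>" by simp
  also have "\<dots> \<le> (\<integral>h. \<bar>I h - K\<bar> \<partial>cube_measure)" by (rule integral_abs_bound)
  also have "\<dots> \<le> (\<integral>h. B * \<omega> h \<partial>cube_measure)"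
    using I_int \<omega>_int I_bd by (intro integral_mono) auto
  finally show ?thesis unfolding I_eq by (simp add: K_def \<omega>_def)
qed

text \<open>The preceding error bound does not contain \<open>y\<close>, whence the uniformity; it
  tends to 0 by dominated convergence in \<open>h\<close>. The filter \<open>at_infinity\<close>
  leaves the sign of \<open>l\<close> free, because the terms obtained by translating
  \<open>x\<close> involve \<open>- l j\<close>.\<close>

lemma averaging_uniform:
  fixes \<sigma> f :: "real ^ 'n \<Rightarrow> real" and l :: "nat \<Rightarrow> real"
  assumes \<sigma>: "integrable lborel \<sigma>"
    and f: "lattice_periodic f" and [measurable]: "f \<in> borel_measurable borel" and B: "\<And>x. \<bar>f x\<bar> \<le> B"
    and l: "filterlim l at_infinity sequentially"
  shows "uniform_limit UNIV (\<lambda>j y. \<integral>\<xi>. \<sigma> \<xi> * f (y + l j *\<^sub>R \<xi>) \<partial>lborel)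
    (\<lambda>_. (\<integral>x. f x \<partial>cube_measure) * (\<integral>\<xi>. \<sigma> \<xi> \<partial>lborel)) sequentially"
proof -
  have [measurable]: "\<sigma> \<in> borel_measurable borel"
    using borel_measurable_integrable[OF \<sigma>] by simp
  define \<omega> where "\<omega> t = (\<integral>\<xi>. \<bar>\<sigma> \<xi> - \<sigma> (\<xi> + t)\<bar> \<partial>lborel)" for t
  have \<omega>_meas [measurable]: "\<omega> \<in> borel_measurable borel"
    unfolding \<omega>_def by measurable
  have \<omega>_bound: "\<bar>\<omega> h\<bar> \<le> 2 * (\<integral>\<xi>. \<bar>\<sigma> \<xi>\<bar> \<partial>lborel)" for h
    using L1_shift_bound[OF \<sigma>, of "\<lambda>_. 0" h] by (simp add: \<omega>_def)
  have inv: "(\<lambda>j. inverse (l j)) \<longlonglongrightarrow> 0"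
    by (rule filterlim_compose[OF tendsto_inverse_0 l])
  have "(\<lambda>j. \<integral>h. \<omega> (- h /\<^sub>R l j) \<partial>cube_measure) \<longlonglongrightarrow> (\<integral>h. 0 \<partial>(cube_measure :: (real ^ 'n) measure))"
  proof (rule integral_dominated_convergence[where w = "\<lambda>_. 2 * (\<integral>\<xi>. \<bar>\<sigma> \<xi>\<bar> \<partial>lborel)"])
    show "AE h in cube_measure. (\<lambda>j. \<omega> (- h /\<^sub>R l j)) \<longlonglongrightarrow> 0"
    proof (rule AE_I2)
      fix h :: "real ^ 'n"
      have "(\<lambda>j. inverse (l j) *\<^sub>R (- h)) \<longlonglongrightarrow> 0 *\<^sub>R (- h)"
        by (intro tendsto_intros inv)
      thus "(\<lambda>j. \<omega> (- h /\<^sub>R l j)) \<longlonglongrightarrow> 0"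
        unfolding \<omega>_def by (intro L1_shift_tendsto[OF \<sigma>]) simp
    qed
  qed (use \<omega>_bound in auto)
  hence lim: "(\<lambda>j. B * (\<integral>h. \<omega> (- h /\<^sub>R l j) \<partial>cube_measure)) \<longlonglongrightarrow> B * 0"
    by (intro tendsto_intros) simp
  show ?thesis
  proof (rule uniform_limitI)
    fix e :: real assume "e > 0"
    hence "eventually (\<lambda>j. B * (\<integral>h. \<omega> (- h /\<^sub>R l j) \<partial>cube_measure) < e) sequentially"
      using order_tendstoD(2)[OF lim, of e] by simp
    moreover have "eventually (\<lambda>j. l j \<noteq> 0) sequentially"
      using l filterlim_at_infinity_imp_eventually_ne by blast
    ultimately show "\<forall>\<^sub>F j in sequentially. \<forall>y\<in>UNIV. dist (\<integral>\<xi>. \<sigma> \<xi> * f (y + l j *\<^sub>R \<xi>) \<partial>lborel)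
        ((\<integral>x. f x \<partial>cube_measure) * (\<integral>\<xi>. \<sigma> \<xi> \<partial>lborel)) < e"
    proof eventually_elim
      case (elim j)
      show ?case
        using averaging_error_le[OF \<sigma> f _ B elim(2)] elim(1)
        by (auto simp: dist_real_def \<omega>_def intro: le_less_trans)
    qed
  qed
qed

text \<open>Averaging \<open>g (h + l *\<^sub>R \<xi>)\<close> over \<open>h\<close> in the cube
  gives the mean of \<open>g\<close> for every \<xi>. Undoing the translation by \<open>h\<close>
  moves \<xi> by h / l, of length at most \<open>r\<close> because the norm on the cube is at most
  the dimension; hence the doubled radius. The constant does not depend on \<open>g\<close>, which
  is essential since \<open>g\<close> will change with the minimizer.\<close>

lemma averaging_lower_bound:
  fixes g :: "real ^ 'n \<Rightarrow> ennreal"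
  assumes g: "lattice_periodic g" and [measurable]: "g \<in> borel_measurable borel"
    and l: "l > 0" "real CARD('n) \<le> l * r"
  shows "emeasure lborel (ball (0 :: real ^ 'n) r) * (\<integral>\<^sup>+h. g h \<partial>cube_measure)
    \<le> (\<integral>\<^sup>+\<xi>. indicator (ball 0 (2 * r)) \<xi> * g (l *\<^sub>R \<xi>) \<partial>lborel)"
proof -
  let ?b = "\<lambda>s. indicator (ball (0 :: real ^ 'n) s) :: real ^ 'n \<Rightarrow> ennreal"
  have [measurable]: "ball (0 :: real ^ 'n) s \<in> sets borel" for s
    by (simp add: borel_open)
  have ball: "(\<integral>\<^sup>+\<xi>. ?b r \<xi> \<partial>lborel) = emeasure lborel (ball (0 :: real ^ 'n) r)"
    by (rule nn_integral_indicator) simp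
  have "emeasure lborel (ball (0 :: real ^ 'n) r) * (\<integral>\<^sup>+h. g h \<partial>cube_measure)
      = (\<integral>\<^sup>+\<xi>. ?b r \<xi> * (\<integral>\<^sup>+h. g h \<partial>cube_measure) \<partial>lborel)"
    using ball by (subst nn_integral_multc) (simp_all add: borel_measurable_indicator)
  also have "\<dots> = (\<integral>\<^sup>+\<xi>. (\<integral>\<^sup>+h. ?b r \<xi> * g (h + l *\<^sub>R \<xi>) \<partial>cube_measure) \<partial>lborel)"
    by (subst nn_integral_cmult) (simp_all add: nn_integral_cube_shift[OF g])
  also have "\<dots> = (\<integral>\<^sup>+h. (\<integral>\<^sup>+\<xi>. ?b r \<xi> * g (h + l *\<^sub>R \<xi>) \<partial>lborel) \<partial>cube_measure)"
    by (rule lborel_cube.Fubini'[symmetric]) measurable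
  also have "\<dots> \<le> (\<integral>\<^sup>+h. (\<integral>\<^sup>+\<xi>. ?b (2 * r) \<xi> * g (l *\<^sub>R \<xi>) \<partial>lborel) \<partial>(cube_measure :: (real ^ 'n) measure))"
  proof (rule nn_integral_mono_AE)
    have "AE h in cube_measure. (h :: real ^ 'n) \<in> unit_cube"
      unfolding cube_measure_def by (subst AE_density) (auto simp: indicator_def)
    thus "AE h in cube_measure. (\<integral>\<^sup>+\<xi>. ?b r \<xi> * g (h + l *\<^sub>R \<xi>) \<partial>lborel)
        \<le> (\<integral>\<^sup>+\<xi>. ?b (2 * r) \<xi> * g (l *\<^sub>R \<xi>) \<partial>lborel)"
    proof (rule AE_mp, intro AE_I2 impI)
      fix h :: "real ^ 'n" assume h: "h \<in> unit_cube"
      have "norm h \<le> (\<Sum>i\<in>UNIV. \<bar>h $ i\<bar>)" by (rule norm_le_l1_cart)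
      also have "\<dots> \<le> (\<Sum>i\<in>(UNIV :: 'n set). 1)"
        using h by (intro sum_mono) (auto simp: unit_cube_def less_imp_le)
      also have "\<dots> \<le> l * r" using l by simp
      finally have hr: "norm (h /\<^sub>R l) \<le> r" using l by (simp add: field_simps)
      have "(\<integral>\<^sup>+\<xi>. ?b r \<xi> * g (h + l *\<^sub>R \<xi>) \<partial>lborel)
          = (\<integral>\<^sup>+\<xi>. ?b r (\<xi> + (- h /\<^sub>R l)) * g (h + l *\<^sub>R (\<xi> + (- h /\<^sub>R l))) \<partial>lborel)"
        by (rule nn_integral_lborel_shift[symmetric]) measurable
      also have "\<dots> = (\<integral>\<^sup>+\<xi>. ?b r (\<xi> + (- h /\<^sub>R l)) * g (l *\<^sub>R \<xi>) \<partial>lborel)"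
        using l by (simp add: scaleR_right_distrib scaleR_diff_right)
      also have "\<dots> \<le> (\<integral>\<^sup>+\<xi>. ?b (2 * r) \<xi> * g (l *\<^sub>R \<xi>) \<partial>lborel)"
      proof (intro nn_integral_mono mult_right_mono)
        fix \<xi> :: "real ^ 'n"
        have "norm \<xi> < 2 * r" if "norm (\<xi> + (- h /\<^sub>R l)) < r"
          using that hr norm_triangle_ineq[of "\<xi> + (- h /\<^sub>R l)" "h /\<^sub>R l"] by simp
        thus "?b r (\<xi> + (- h /\<^sub>R l)) \<le> ?b (2 * r) \<xi>"
          by (auto simp: indicator_def)
      qed simp
      finally show "(\<integral>\<^sup>+\<xi>. ?b r \<xi> * g (h + l *\<^sub>R \<xi>) \<partial>lborel) \<le> \<dots>" .
    qed
  qed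
  also have "\<dots> = (\<integral>\<^sup>+\<xi>. ?b (2 * r) \<xi> * g (l *\<^sub>R \<xi>) \<partial>lborel)"
    by (simp add: emeasure_cube_measure_space)
  finally show ?thesis .
qed

section \<open>Integrals over pairs (\<xi>, x) and their limits\<close>

lemma integrable_mult_bounded:
  fixes f g :: "'a \<Rightarrow> real"
  assumes f: "integrable N f" and g: "g \<in> borel_measurable N" "\<And>x. \<bar>g x\<bar> \<le> B"
  shows "integrable N (\<lambda>x. f x * g x)"
proof (rule Bochner_Integration.integrable_bound[of _ "\<lambda>x. B * f x"])
  show "(\<lambda>x. f x * g x) \<in> borel_measurable N"
    using g(1) borel_measurable_integrable[OF f] by simp
  have "\<bar>f x\<bar> * \<bar>g x\<bar> \<le> \<bar>f x\<bar> * B" for x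
    using g(2) by (intro mult_left_mono) auto
  moreover have "0 \<le> B" using g(2)[of undefined] by (rule order_trans[OF abs_ge_zero])
  ultimately show "AE x in N. norm (f x * g x) \<le> norm (B * f x)"
    by (intro AE_I2) (simp add: abs_mult mult.commute)
qed (use f in simp)

lemma integrable_prod_mult:
  fixes \<sigma> :: "real ^ 'm \<Rightarrow> real" and h :: "real ^ 'n \<Rightarrow> real"
  assumes \<sigma>: "integrable lborel \<sigma>" and h: "integrable cube_measure h"
  shows "integrable (lborel \<Otimes>\<^sub>M cube_measure) (\<lambda>(\<xi>, x). \<sigma> \<xi> * h x)"
proof -
  have [measurable]: "\<sigma> \<in> borel_measurable borel" "h \<in> borel_measurable borel"
    using borel_measurable_integrable[OF \<sigma>] borel_measurable_integrable[OF h] by simp_all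
  show ?thesis
    using \<sigma> h by (intro lborel_cube.Fubini_integrable) (auto simp: abs_mult)
qed

text \<open>For each fixed \<xi> the translation of \<open>x\<close> by \<open>s \<xi>\<close>
  preserves the integral over the cube. This is the tool that moves the argument of the minimizer
  back to \<open>x\<close>.\<close>

lemma
  fixes H :: "(real ^ 'm) \<times> (real ^ 'n) \<Rightarrow> real"
  assumes per: "\<And>\<xi>. lattice_periodic (\<lambda>x. H (\<xi>, x))" and s [measurable]: "s \<in> borel_measurable borel"
    and H: "integrable (lborel \<Otimes>\<^sub>M cube_measure) H"
  shows integrable_prod_shift: "integrable (lborel \<Otimes>\<^sub>M cube_measure) (\<lambda>(\<xi>, x). H (\<xi>, x + s \<xi>))"
    and integral_prod_shift: "(\<integral>(\<xi>, x). H (\<xi>, x + s \<xi>) \<partial>(lborel \<Otimes>\<^sub>M cube_measure))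
      = (\<integral>p. H p \<partial>(lborel \<Otimes>\<^sub>M cube_measure))"
proof -
  have [measurable]: "H \<in> borel_measurable (borel \<Otimes>\<^sub>M borel)"
    using borel_measurable_integrable[OF H] by simp
  have "(\<integral>\<^sup>+(\<xi>, x). ennreal \<bar>H (\<xi>, x + s \<xi>)\<bar> \<partial>(lborel \<Otimes>\<^sub>M cube_measure))
      = (\<integral>\<^sup>+\<xi>. (\<integral>\<^sup>+x. ennreal \<bar>H (\<xi>, x + s \<xi>)\<bar> \<partial>cube_measure) \<partial>lborel)"
    by (subst cube_measure.nn_integral_fst[symmetric]) auto
  also have "\<dots> = (\<integral>\<^sup>+\<xi>. (\<integral>\<^sup>+x. ennreal \<bar>H (\<xi>, x)\<bar> \<partial>cube_measure) \<partial>lborel)"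
  proof (rule nn_integral_cong)
    fix \<xi>
    have "lattice_periodic (\<lambda>x. ennreal \<bar>H (\<xi>, x)\<bar>)"
      using per by (simp add: lattice_periodic_def)
    thus "(\<integral>\<^sup>+x. ennreal \<bar>H (\<xi>, x + s \<xi>)\<bar> \<partial>cube_measure) = (\<integral>\<^sup>+x. ennreal \<bar>H (\<xi>, x)\<bar> \<partial>cube_measure)"
      by (rule nn_integral_cube_shift) measurable
  qed
  also have "\<dots> = (\<integral>\<^sup>+p. ennreal \<bar>H p\<bar> \<partial>(lborel \<Otimes>\<^sub>M cube_measure))"
    by (subst cube_measure.nn_integral_fst) auto
  also have "\<dots> < \<infinity>" using H by (simp add: integrable_iff_bounded)
  finally show int: "integrable (lborel \<Otimes>\<^sub>M cube_measure) (\<lambda>(\<xi>, x). H (\<xi>, x + s \<xi>))"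
    by (auto simp: integrable_iff_bounded case_prod_unfold)
  have "(\<integral>(\<xi>, x). H (\<xi>, x + s \<xi>) \<partial>(lborel \<Otimes>\<^sub>M cube_measure))
      = (\<integral>\<xi>. (\<integral>x. H (\<xi>, x + s \<xi>) \<partial>cube_measure) \<partial>lborel)"
    using lborel_cube.integral_fst'[OF int] by simp
  also have "\<dots> = (\<integral>\<xi>. (\<integral>x. H (\<xi>, x) \<partial>cube_measure) \<partial>lborel)"
    by (intro Bochner_Integration.integral_cong integral_cube_shift per) auto
  also have "\<dots> = (\<integral>p. H p \<partial>(lborel \<Otimes>\<^sub>M cube_measure))"
    using lborel_cube.integral_fst'[OF H] by simp
  finally show "(\<integral>(\<xi>, x). H (\<xi>, x + s \<xi>) \<partial>(lborel \<Otimes>\<^sub>M cube_measure))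
      = (\<integral>p. H p \<partial>(lborel \<Otimes>\<^sub>M cube_measure))" .
qed

text \<open>Integrate in \<xi> first: the result \<open>K j x\<close> tends to a constant uniformly
  in \<open>x\<close>, and a uniformly small error times a function bounded in L1 has a small
  integral. Only the means of \<open>h j\<close> then survive, so no strong convergence of
  \<open>h j\<close> is required.\<close>

lemma averaging_limit:
  fixes \<sigma> q :: "real ^ 'n \<Rightarrow> real" and h :: "nat \<Rightarrow> real ^ 'n \<Rightarrow> real" and l :: "nat \<Rightarrow> real"
  assumes \<sigma>: "integrable lborel \<sigma>"
    and q: "lattice_periodic q" and q_meas [measurable]: "q \<in> borel_measurable borel"
    and B: "\<And>x. \<bar>q x\<bar> \<le> B"
    and l: "filterlim l at_infinity sequentially"
    and h: "\<And>j. integrable cube_measure (h j)"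
    and C: "eventually (\<lambda>j. (\<integral>x. \<bar>h j x\<bar> \<partial>cube_measure) \<le> C) sequentially"
    and lim: "(\<lambda>j. \<integral>x. h j x \<partial>cube_measure) \<longlonglongrightarrow> \<eta>"
  shows "(\<lambda>j. \<integral>(\<xi>, x). \<sigma> \<xi> * h j x * q (x + l j *\<^sub>R \<xi>) \<partial>(lborel \<Otimes>\<^sub>M cube_measure))
    \<longlonglongrightarrow> \<eta> * ((\<integral>x. q x \<partial>cube_measure) * (\<integral>\<xi>. \<sigma> \<xi> \<partial>lborel))"
proof -
  have [measurable]: "\<sigma> \<in> borel_measurable borel" "h j \<in> borel_measurable borel" for j
    using borel_measurable_integrable[OF \<sigma>] borel_measurable_integrable[OF h] by simp_all
  define k where "k = (\<integral>x. q x \<partial>cube_measure) * (\<integral>\<xi>. \<sigma> \<xi> \<partial>lborel)"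
  define K where "K j x = (\<integral>\<xi>. \<sigma> \<xi> * q (x + l j *\<^sub>R \<xi>) \<partial>lborel)" for j x
  have K_meas [measurable]: "K j \<in> borel_measurable borel" for j
    unfolding K_def by measurable
  have K_lim: "uniform_limit UNIV K (\<lambda>_. k) sequentially"
    unfolding K_def k_def by (rule averaging_uniform[OF \<sigma> q q_meas B l])
  have K_bound: "\<bar>K j x\<bar> \<le> B * (\<integral>\<xi>. \<bar>\<sigma> \<xi>\<bar> \<partial>lborel)" for j x
  proof -
    have "\<bar>K j x\<bar> \<le> (\<integral>\<xi>. \<bar>\<sigma> \<xi> * q (x + l j *\<^sub>R \<xi>)\<bar> \<partial>lborel)"
      unfolding K_def by (rule integral_abs_bound)
    also have "\<dots> \<le> (\<integral>\<xi>. B * \<bar>\<sigma> \<xi>\<bar> \<partial>lborel)"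
    proof (rule integral_mono)
      show "integrable lborel (\<lambda>\<xi>. \<bar>\<sigma> \<xi> * q (x + l j *\<^sub>R \<xi>)\<bar>)"
        using B by (intro integrable_abs integrable_mult_bounded[OF \<sigma>]) auto
      show "\<bar>\<sigma> \<xi> * q (x + l j *\<^sub>R \<xi>)\<bar> \<le> B * \<bar>\<sigma> \<xi>\<bar>" for \<xi>
        unfolding abs_mult mult.commute[of B] using B by (intro mult_left_mono) auto
    qed (use \<sigma> in auto)
    finally show ?thesis by simp
  qed
  have eq: "(\<integral>(\<xi>, x). \<sigma> \<xi> * h j x * q (x + l j *\<^sub>R \<xi>) \<partial>(lborel \<Otimes>\<^sub>M cube_measure))
      = (\<integral>x. h j x * K j x \<partial>cube_measure)" for j
  proof -
    have "integrable (lborel \<Otimes>\<^sub>M cube_measure) (\<lambda>p. (case p of (\<xi>, x) \<Rightarrow> \<sigma> \<xi> * h j x) *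
        (case p of (\<xi>, x) \<Rightarrow> q (x + l j *\<^sub>R \<xi>)))"
      using B by (intro integrable_mult_bounded[OF integrable_prod_mult[OF \<sigma> h]]) auto
    hence "integrable (lborel \<Otimes>\<^sub>M cube_measure) (\<lambda>(\<xi>, x). \<sigma> \<xi> * h j x * q (x + l j *\<^sub>R \<xi>))"
      by (simp add: case_prod_unfold)
    from lborel_cube.integral_snd[OF this]
    have "(\<integral>(\<xi>, x). \<sigma> \<xi> * h j x * q (x + l j *\<^sub>R \<xi>) \<partial>(lborel \<Otimes>\<^sub>M cube_measure))
       = (\<integral>x. (\<integral>\<xi>. \<sigma> \<xi> * h j x * q (x + l j *\<^sub>R \<xi>) \<partial>lborel) \<partial>cube_measure)" by simp
    also have "\<dots> = (\<integral>x. h j x * K j x \<partial>cube_measure)"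
      unfolding K_def by (subst integral_mult_right_zero[symmetric]) (simp add: mult_ac)
    finally show ?thesis .
  qed
  have "(\<lambda>j. (\<integral>x. h j x * K j x \<partial>cube_measure) - k * (\<integral>x. h j x \<partial>cube_measure)) \<longlonglongrightarrow> 0"
  proof (rule tendstoI)
    fix e :: real assume e: "e > 0"
    \<comment> \<open>The added 1 avoids division by zero and makes the final estimate
      strict.\<close>
    define e' where "e' = e / (\<bar>C\<bar> + 1)"
    have e': "e' > 0" using e by (simp add: e'_def)
    have "eventually (\<lambda>j. \<forall>x\<in>UNIV. dist (K j x) k < e') sequentially"
      using uniform_limitD[OF K_lim e'] .
    thus "eventually (\<lambda>j. dist ((\<integral>x. h j x * K j x \<partial>cube_measure) - k * (\<integral>x. h j x \<partial>cube_measure)) 0 < e) sequentially"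
      using C
    proof eventually_elim
      case (elim j)
      have int: "integrable cube_measure (\<lambda>x. h j x * K j x)"
        by (rule integrable_mult_bounded[OF h _ K_bound]) simp
      have "(\<integral>x. h j x * K j x \<partial>cube_measure) - k * (\<integral>x. h j x \<partial>cube_measure)
          = (\<integral>x. h j x * K j x - k * h j x \<partial>cube_measure)"
        using int h by simp
      also have "\<bar>\<dots>\<bar> \<le> (\<integral>x. \<bar>h j x * K j x - k * h j x\<bar> \<partial>cube_measure)"
        by (rule integral_abs_bound)
      also have "\<dots> \<le> (\<integral>x. e' * \<bar>h j x\<bar> \<partial>cube_measure)"
      proof (rule integral_mono)
        fix x
        have "\<bar>h j x * K j x - k * h j x\<bar> = \<bar>K j x - k\<bar> * \<bar>h j x\<bar>"
          by (simp add: abs_mult[symmetric] algebra_simps)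
        also have "\<dots> \<le> e' * \<bar>h j x\<bar>"
          using elim(1) by (intro mult_right_mono) (auto simp: dist_real_def less_imp_le)
        finally show "\<bar>h j x * K j x - k * h j x\<bar> \<le> e' * \<bar>h j x\<bar>" .
      qed (use int h in auto)
      also have "\<dots> = e' * (\<integral>x. \<bar>h j x\<bar> \<partial>cube_measure)" by simp
      also have "\<dots> \<le> e' * \<bar>C\<bar>" using elim(2) e' by (intro mult_left_mono) auto
      also have "\<dots> < e' * (\<bar>C\<bar> + 1)" using e' by (intro mult_strict_left_mono) auto
      also have "\<dots> = e" by (simp add: e'_def)
      finally show ?case by (simp add: dist_real_def)
    qed
  qed
  from tendsto_add[OF this tendsto_mult_left[OF lim, of k]] show ?thesis
    unfolding eq k_def[symmetric] by (simp add: mult.commute)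
qed

lemma linear_coeff_zero_if_quadratic_nonneg:
  fixes B C :: real
  assumes "\<And>t. 0 \<le> 2 * t * B + t\<^sup>2 * C"
  shows "B = 0"
proof (rule ccontr)
  assume B: "B \<noteq> 0"
  \<comment> \<open>If \<open>C\<close> is positive, the parabola has its minimum at - B / C.
    Replacing \<open>C\<close> by a larger positive number keeps the value negative and covers
    \<open>C \<le> 0\<close> as well.\<close>
  define c where "c = \<bar>C\<bar> + 1"
  have c: "c > 0" "C < c" by (auto simp: c_def)
  have "2 * (- B / c) * B + (- B / c)\<^sup>2 * C = - (B\<^sup>2 / c) * (2 - C / c)"
    using c by (simp add: field_simps power2_eq_square)
  moreover have "B\<^sup>2 / c > 0" "2 - C / c > 0" using c B by (auto simp: field_simps)
  ultimately have "2 * (- B / c) * B + (- B / c)\<^sup>2 * C < 0"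
    by (metis mult_minus_left mult_pos_pos neg_less_0_iff_less)
  thus False using assms[of "- B / c"] by simp
qed

section \<open>Minimizers of the periodic energy\<close>

text \<open>On a space of mass 1 this passes from L2 to L1 bounds without Cauchy--Schwarz; it also
  gives the first moment of \<rho> from its mass and its second moment.\<close>

lemma abs_le_one_plus_square: "\<bar>t\<bar> \<le> 1 + t\<^sup>2" for t :: real
  using zero_le_power2[of "\<bar>t\<bar> - 1"] by (simp add: power2_diff)

text \<open>For \<open>l \<noteq> 0\<close> this is the difference quotient of
  \<open>N \<bullet> x + l * \<phi> x\<close> along \<open>l *\<^sub>R \<xi>\<close>. The slope is a
  parameter because minimizers occur with \<open>N = M\<close> and variations with
  \<open>N = 0\<close>.\<close>

definition increment :: "real ^ 'n \<Rightarrow> real \<Rightarrow> (real ^ 'n \<Rightarrow> real) \<Rightarrow> real ^ 'n \<Rightarrow> real ^ 'n \<Rightarrow> real" where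
  "increment N l \<phi> \<xi> x = N \<bullet> \<xi> + (\<phi> (x + l *\<^sub>R \<xi>) - \<phi> x)"

lemma increment_meas [measurable]:
  assumes [measurable]: "\<phi> \<in> borel_measurable borel"
  shows "(\<lambda>(\<xi>, x). increment N l \<phi> \<xi> x) \<in> borel_measurable (borel \<Otimes>\<^sub>M borel)"
  unfolding increment_def by measurable

definition cube_L2 :: "(real ^ 'n \<Rightarrow> real) set" where
  "cube_L2 = {\<phi> \<in> borel_measurable borel. lattice_periodic \<phi> \<and> integrable cube_measure (\<lambda>x. (\<phi> x)\<^sup>2)}"

lemma bounded_in_cube_L2:
  assumes "\<phi> \<in> borel_measurable borel" "lattice_periodic \<phi>" "\<And>x. \<bar>\<phi> x\<bar> \<le> B"
  shows "\<phi> \<in> cube_L2"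
proof -
  have "\<bar>(\<phi> x)\<^sup>2\<bar> \<le> B\<^sup>2" for x
    using assms(3)[of x] by (simp add: abs_le_square_iff[symmetric])
  thus ?thesis
    unfolding cube_L2_def using assms by (auto intro!: integrable_cube_bounded[of _ "B\<^sup>2"])
qed

lemma cube_L2_add:
  assumes w: "w \<in> cube_L2" and \<phi>: "\<phi> \<in> cube_L2"
  shows "(\<lambda>x. w x + \<phi> x) \<in> cube_L2"
proof -
  have "integrable cube_measure (\<lambda>x. (w x + \<phi> x)\<^sup>2)"
  proof (rule Bochner_Integration.integrable_bound)
    show "integrable cube_measure (\<lambda>x. 2 * (w x)\<^sup>2 + 2 * (\<phi> x)\<^sup>2)"
      using assms by (auto simp: cube_L2_def)
    have "(p + q)\<^sup>2 \<le> 2 * p\<^sup>2 + 2 * q\<^sup>2" for p q :: real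
      using zero_le_power2[of "p - q"] by (simp add: power2_sum power2_diff)
    thus "AE x in cube_measure. norm ((w x + \<phi> x)\<^sup>2) \<le> norm (2 * (w x)\<^sup>2 + 2 * (\<phi> x)\<^sup>2)"
      by (intro AE_I2) simp
  qed (use assms in \<open>auto simp: cube_L2_def\<close>)
  thus ?thesis using assms by (auto simp: cube_L2_def lattice_periodic_def)
qed

text \<open>\<open>\<phi>\<close> stands for \<open>v / l\<close>, where \<open>u x = M \<bullet> x + v x\<close>.\<close>

definition periodic_cube_energy ::
  "(real ^ 'n \<Rightarrow> real) \<Rightarrow> (real ^ 'n \<Rightarrow> real) \<Rightarrow> real ^ 'n \<Rightarrow> real \<Rightarrow> (real ^ 'n \<Rightarrow> real) \<Rightarrow> ennreal" where
  "periodic_cube_energy \<rho> a M l \<phi> = (\<integral>\<^sup>+\<xi>. ennreal (\<rho> \<xi>) *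
     (\<integral>\<^sup>+x. ennreal (a x * (increment M l \<phi> \<xi> x)\<^sup>2) \<partial>cube_measure) \<partial>lborel)"

text \<open>The bounds and the periodicity of \<open>a\<close> hold at every point here; the given
  coefficient has them only almost everywhere and is first replaced by a truncated periodic
  representative.\<close>

locale periodic_energy =
  fixes \<rho> a :: "real ^ 'n \<Rightarrow> real" and M :: "real ^ 'n" and \<alpha> \<beta> c0 r0 :: real
  assumes rho_int: "integrable lborel \<rho>"
    and rho_nonneg: "\<And>\<xi>. 0 \<le> \<rho> \<xi>"
    and rho_moment: "integrable lborel (\<lambda>\<xi>. \<rho> \<xi> * (norm \<xi>)\<^sup>2)"
    and c0_pos: "0 < c0" and r0_pos: "0 < r0"
    and rho_lower: "AE \<xi> in lborel. \<xi> \<in> ball 0 r0 \<longrightarrow> c0 \<le> \<rho> \<xi>"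
    and a_periodic: "lattice_periodic a"
    and a_meas [measurable]: "a \<in> borel_measurable borel"
    and alpha_pos: "0 < \<alpha>"
    and a_lower: "\<And>x. \<alpha> \<le> a x" and a_upper: "\<And>x. a x \<le> \<beta>"
begin

abbreviation cube_energy :: "real \<Rightarrow> (real ^ 'n \<Rightarrow> real) \<Rightarrow> ennreal" where
  "cube_energy \<equiv> periodic_cube_energy \<rho> a M"

lemma rho_meas [measurable]: "\<rho> \<in> borel_measurable borel"
  using borel_measurable_integrable[OF rho_int] by simp

lemma a_nonneg: "0 \<le> a x"
  using alpha_pos a_lower[of x] by linarith

lemma a_abs: "\<bar>a x\<bar> \<le> \<beta>"
  using a_nonneg a_upper by simp

lemma a_sq_abs: "\<bar>(a x)\<^sup>2\<bar> \<le> \<beta>\<^sup>2"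
  using power_mono[OF a_upper a_nonneg, of x 2] by simp

text \<open>The square splits into three parts: the linear one is integrable by the second moment of
  \<rho>, the other two by Fubini and by translation invariance on the cube.\<close>

lemma integrable_increment_sq:
  assumes "\<phi> \<in> cube_L2"
  shows "integrable (lborel \<Otimes>\<^sub>M cube_measure) (\<lambda>(\<xi>, x). \<rho> \<xi> * (increment N l \<phi> \<xi> x)\<^sup>2)"
proof -
  have [measurable]: "\<phi> \<in> borel_measurable borel" and per: "lattice_periodic \<phi>"
    and sq: "integrable cube_measure (\<lambda>x. (\<phi> x)\<^sup>2)"
    using assms by (auto simp: cube_L2_def)
  have "integrable lborel (\<lambda>\<xi>. \<rho> \<xi> * (N \<bullet> \<xi>)\<^sup>2)"
  proof (rule Bochner_Integration.integrable_bound)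
    show "integrable lborel (\<lambda>\<xi>. (norm N)\<^sup>2 * (\<rho> \<xi> * (norm \<xi>)\<^sup>2))" using rho_moment by simp
    have "\<rho> \<xi> * (N \<bullet> \<xi>)\<^sup>2 \<le> \<rho> \<xi> * ((norm N)\<^sup>2 * (norm \<xi>)\<^sup>2)" for \<xi>
      using Cauchy_Schwarz_ineq[of N \<xi>] rho_nonneg
      by (intro mult_left_mono) (auto simp: power2_norm_eq_inner)
    thus "AE \<xi> in lborel. norm (\<rho> \<xi> * (N \<bullet> \<xi>)\<^sup>2) \<le> norm ((norm N)\<^sup>2 * (\<rho> \<xi> * (norm \<xi>)\<^sup>2))"
      using rho_nonneg by (intro AE_I2) (simp add: abs_mult mult_ac)
  qed measurable
  from integrable_prod_mult[OF this, of "\<lambda>_. 1"]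
  have 1: "integrable (lborel \<Otimes>\<^sub>M cube_measure) (\<lambda>(\<xi>, x :: real ^ 'n). \<rho> \<xi> * (N \<bullet> \<xi>)\<^sup>2)"
    by simp
  have 2: "integrable (lborel \<Otimes>\<^sub>M cube_measure) (\<lambda>(\<xi>, x). \<rho> \<xi> * (\<phi> x)\<^sup>2)"
    by (rule integrable_prod_mult[OF rho_int sq])
  have 3: "integrable (lborel \<Otimes>\<^sub>M cube_measure) (\<lambda>(\<xi>, x). \<rho> \<xi> * (\<phi> (x + l *\<^sub>R \<xi>))\<^sup>2)"
    using integrable_prod_shift[OF _ _ 2, of "\<lambda>\<xi>. l *\<^sub>R \<xi>"] per
    by (simp add: lattice_periodic_def)
  have "integrable (lborel \<Otimes>\<^sub>M cube_measure) (\<lambda>p. 3 * ((case p of (\<xi>, x :: real ^ 'n) \<Rightarrow> \<rho> \<xi> * (N \<bullet> \<xi>)\<^sup>2)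
      + (case p of (\<xi>, x) \<Rightarrow> \<rho> \<xi> * (\<phi> (x + l *\<^sub>R \<xi>))\<^sup>2) + (case p of (\<xi>, x) \<Rightarrow> \<rho> \<xi> * (\<phi> x)\<^sup>2)))"
    by (intro integrable_mult_right Bochner_Integration.integrable_add 1 2 3)
  thus ?thesis
  proof (rule Bochner_Integration.integrable_bound)
    \<comment> \<open>The difference of the two sides is (p - q)^2 + (p + r)^2 + (q + r)^2.\<close>
    have ineq: "(p + (q - r))\<^sup>2 \<le> 3 * (p\<^sup>2 + q\<^sup>2 + r\<^sup>2)" for p q r :: real
      using sum_squares_ge_zero[of "p - q" "p + r"] sum_power2_ge_zero[of "q + r" 0]
      by (simp add: power2_eq_square algebra_simps)
    have "\<rho> \<xi> * (increment N l \<phi> \<xi> x)\<^sup>2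
        \<le> \<rho> \<xi> * (3 * ((N \<bullet> \<xi>)\<^sup>2 + (\<phi> (x + l *\<^sub>R \<xi>))\<^sup>2 + (\<phi> x)\<^sup>2))" for \<xi> x
      unfolding increment_def by (intro mult_left_mono ineq rho_nonneg)
    thus "AE p in lborel \<Otimes>\<^sub>M cube_measure. norm (case p of (\<xi>, x) \<Rightarrow> \<rho> \<xi> * (increment N l \<phi> \<xi> x)\<^sup>2)
      \<le> norm (3 * ((case p of (\<xi>, x :: real ^ 'n) \<Rightarrow> \<rho> \<xi> * (N \<bullet> \<xi>)\<^sup>2)
      + (case p of (\<xi>, x) \<Rightarrow> \<rho> \<xi> * (\<phi> (x + l *\<^sub>R \<xi>))\<^sup>2) + (case p of (\<xi>, x) \<Rightarrow> \<rho> \<xi> * (\<phi> x)\<^sup>2)))"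
      using rho_nonneg by (intro AE_I2) (auto simp: abs_mult algebra_simps)
  qed measurable
qed

lemma integrable_energy_density:
  assumes "\<phi> \<in> cube_L2"
  shows "integrable (lborel \<Otimes>\<^sub>M cube_measure) (\<lambda>(\<xi>, x). \<rho> \<xi> * (a x * (increment N l \<phi> \<xi> x)\<^sup>2))"
proof -
  have "integrable (lborel \<Otimes>\<^sub>M cube_measure)
      (\<lambda>p. (case p of (\<xi>, x) \<Rightarrow> \<rho> \<xi> * (increment N l \<phi> \<xi> x)\<^sup>2) * (case p of (\<xi>, x) \<Rightarrow> a x))"
    by (rule integrable_mult_bounded[OF integrable_increment_sq[OF assms], of _ \<beta>]) (use a_abs in auto)
  thus ?thesis by (simp add: case_prod_unfold mult_ac)
qed

text \<open>Finiteness on \<open>cube_L2\<close> turns the extended-valued energy into a real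
  number, so that its values along a line can be expanded and subtracted.\<close>

lemma cube_energy_eq_integral:
  assumes \<phi>: "\<phi> \<in> cube_L2"
  shows "cube_energy l \<phi> = ennreal (\<integral>(\<xi>, x). \<rho> \<xi> * (a x * (increment M l \<phi> \<xi> x)\<^sup>2) \<partial>(lborel \<Otimes>\<^sub>M cube_measure))"
proof -
  have [measurable]: "\<phi> \<in> borel_measurable borel" using assms by (auto simp: cube_L2_def)
  have "cube_energy l \<phi> = (\<integral>\<^sup>+\<xi>. (\<integral>\<^sup>+x. ennreal (\<rho> \<xi> * (a x * (increment M l \<phi> \<xi> x)\<^sup>2)) \<partial>cube_measure) \<partial>lborel)"
    unfolding periodic_cube_energy_def
    by (subst nn_integral_cmult[symmetric]) (auto simp: ennreal_mult'[OF rho_nonneg])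
  also have "\<dots> = (\<integral>\<^sup>+(\<xi>, x). ennreal (\<rho> \<xi> * (a x * (increment M l \<phi> \<xi> x)\<^sup>2)) \<partial>(lborel \<Otimes>\<^sub>M cube_measure))"
    by (subst cube_measure.nn_integral_fst[symmetric]) auto
  also have "\<dots> = ennreal (\<integral>(\<xi>, x). \<rho> \<xi> * (a x * (increment M l \<phi> \<xi> x)\<^sup>2) \<partial>(lborel \<Otimes>\<^sub>M cube_measure))"
    using nn_integral_eq_integral[OF integrable_energy_density[OF \<phi>, of M l]] rho_nonneg a_nonneg
    by (simp add: case_prod_unfold)
  finally show ?thesis .
qed

text \<open>Along \<open>w + t * \<phi>\<close> the energy is a quadratic polynomial in
  \<open>t\<close> with minimum at 0, so its linear coefficient, twice the integral in question,
  vanishes.\<close>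

lemma euler_lagrange:
  assumes w: "w \<in> cube_L2"
    and \<phi>: "\<phi> \<in> cube_L2"
    and min: "\<And>t. cube_energy l w \<le> cube_energy l (\<lambda>x. w x + t * \<phi> x)"
  shows "(\<integral>(\<xi>, x). \<rho> \<xi> * (a x * (increment M l w \<xi> x * increment 0 l \<phi> \<xi> x)) \<partial>(lborel \<Otimes>\<^sub>M cube_measure)) = 0"
proof (rule linear_coeff_zero_if_quadratic_nonneg)
  have [measurable]: "w \<in> borel_measurable borel" "\<phi> \<in> borel_measurable borel"
    using w \<phi> by (auto simp: cube_L2_def)
  let ?N = "lborel \<Otimes>\<^sub>M cube_measure :: ((real ^ 'n) \<times> (real ^ 'n)) measure"
  define D where "D \<xi> x = \<rho> \<xi> * (a x * (increment M l w \<xi> x * increment 0 l \<phi> \<xi> x))" for \<xi> x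
  define E where "E \<xi> x = \<rho> \<xi> * (a x * (increment M l w \<xi> x)\<^sup>2)" for \<xi> x
  define G where "G \<xi> x = \<rho> \<xi> * (a x * (increment 0 l \<phi> \<xi> x)\<^sup>2)" for \<xi> x
  have E: "integrable ?N (\<lambda>(\<xi>, x). E \<xi> x)" unfolding E_def by (rule integrable_energy_density[OF w])
  have G: "integrable ?N (\<lambda>(\<xi>, x). G \<xi> x)" unfolding G_def by (rule integrable_energy_density[OF \<phi>])
  have D: "integrable ?N (\<lambda>(\<xi>, x). D \<xi> x)"
  proof (rule Bochner_Integration.integrable_bound)
    show "integrable ?N (\<lambda>p. (case p of (\<xi>, x) \<Rightarrow> E \<xi> x) + (case p of (\<xi>, x) \<Rightarrow> G \<xi> x))"
      by (intro Bochner_Integration.integrable_add E G)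
    have "\<bar>p * q\<bar> \<le> p\<^sup>2 + q\<^sup>2" for p q :: real
    proof -
      have "2 * (\<bar>p\<bar> * \<bar>q\<bar>) \<le> p\<^sup>2 + q\<^sup>2"
        using zero_le_power2[of "\<bar>p\<bar> - \<bar>q\<bar>"] by (simp add: power2_diff)
      moreover have "0 \<le> \<bar>p\<bar> * \<bar>q\<bar>" by simp
      ultimately show ?thesis unfolding abs_mult by linarith
    qed
    hence "\<rho> \<xi> * (a x * \<bar>increment M l w \<xi> x * increment 0 l \<phi> \<xi> x\<bar>)
       \<le> \<rho> \<xi> * (a x * ((increment M l w \<xi> x)\<^sup>2 + (increment 0 l \<phi> \<xi> x)\<^sup>2))" for \<xi> x
      by (intro mult_left_mono rho_nonneg a_nonneg)
    thus "AE p in ?N. norm (case p of (\<xi>, x) \<Rightarrow> D \<xi> x) \<le>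
        norm ((case p of (\<xi>, x) \<Rightarrow> E \<xi> x) + (case p of (\<xi>, x) \<Rightarrow> G \<xi> x))"
      using rho_nonneg a_nonneg
      by (intro AE_I2) (auto simp: D_def E_def G_def abs_mult distrib_left)
  qed (unfold D_def, measurable)
  fix t :: real
  have t\<phi>: "(\<lambda>x. t * \<phi> x) \<in> cube_L2"
    using \<phi> by (auto simp: cube_L2_def lattice_periodic_def power_mult_distrib)
  have wt: "(\<lambda>x. w x + t * \<phi> x) \<in> cube_L2"
    by (rule cube_L2_add[OF w t\<phi>])
  have int_nonneg: "0 \<le> (\<integral>(\<xi>, x). \<rho> \<xi> * (a x * (increment M l (\<lambda>x. w x + t * \<phi> x) \<xi> x)\<^sup>2) \<partial>?N)"
    using rho_nonneg a_nonneg by (intro Bochner_Integration.integral_nonneg) auto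
  have "(\<integral>(\<xi>, x). E \<xi> x \<partial>?N) \<le> (\<integral>(\<xi>, x). \<rho> \<xi> * (a x * (increment M l (\<lambda>x. w x + t * \<phi> x) \<xi> x)\<^sup>2) \<partial>?N)"
    using min[of t] int_nonneg
    unfolding cube_energy_eq_integral[OF w] cube_energy_eq_integral[OF wt] E_def
    by (subst (asm) ennreal_le_iff) auto
  also have "\<dots> = (\<integral>p. (case p of (\<xi>, x) \<Rightarrow> E \<xi> x) + (2 * t * (case p of (\<xi>, x) \<Rightarrow> D \<xi> x)
      + t\<^sup>2 * (case p of (\<xi>, x) \<Rightarrow> G \<xi> x)) \<partial>?N)"
    by (intro Bochner_Integration.integral_cong)
       (auto simp: E_def D_def G_def increment_def power2_eq_square algebra_simps)
  also have "\<dots> = (\<integral>(\<xi>, x). E \<xi> x \<partial>?N) + (2 * t * (\<integral>(\<xi>, x). D \<xi> x \<partial>?N) + t\<^sup>2 * (\<integral>(\<xi>, x). G \<xi> x \<partial>?N))"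
    using E D G by simp
  finally show "0 \<le> 2 * t * (\<integral>(\<xi>, x). \<rho> \<xi> * (a x * (increment M l w \<xi> x * increment 0 l \<phi> \<xi> x)) \<partial>?N)
      + t\<^sup>2 * (\<integral>(\<xi>, x). G \<xi> x \<partial>?N)"
    by (simp add: D_def)
qed

text \<open>Comparison with the affine competitor bounds the increments of the minimizer in \<open>L\<^sup>2\<close>.\<close>

lemma increment_energy_bound:
  assumes w: "w \<in> cube_L2" and min: "cube_energy l w \<le> cube_energy l (\<lambda>_. 0)"
  shows "(\<integral>\<^sup>+\<xi>. ennreal (\<rho> \<xi>) * (\<integral>\<^sup>+x. ennreal ((w (x + l *\<^sub>R \<xi>) - w x)\<^sup>2) \<partial>cube_measure) \<partial>lborel)
    \<le> ennreal (4 / \<alpha> * (\<beta> * (\<integral>\<xi>. \<rho> \<xi> * (M \<bullet> \<xi>)\<^sup>2 \<partial>lborel)))"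
proof -
  have [measurable]: "w \<in> borel_measurable borel"
    using w by (auto simp: cube_L2_def)
  let ?N = "lborel \<Otimes>\<^sub>M cube_measure :: ((real ^ 'n) \<times> (real ^ 'n)) measure"
  \<comment> \<open>With coefficient 1 and slope 0 the energy of \<open>w\<close> is the weighted
    integral of its squared increments, so the lemmas on the energy apply to that integral
    too.\<close>
  interpret unit: periodic_energy \<rho> "\<lambda>_. 1" 0 1 1 c0 r0
    using rho_int rho_nonneg rho_moment c0_pos r0_pos rho_lower
    by unfold_locales (auto simp: lattice_periodic_def)
  define S where "S = (\<integral>(\<xi>, x). \<rho> \<xi> * (1 * (increment 0 l w \<xi> x)\<^sup>2) \<partial>?N)"
  define E where "E \<phi> = (\<integral>(\<xi>, x). \<rho> \<xi> * (a x * (increment M l \<phi> \<xi> x)\<^sup>2) \<partial>?N)" for \<phi>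
  have 0: "(\<lambda>_. 0) \<in> cube_L2"
    by (auto simp: cube_L2_def lattice_periodic_def)
  have E0_nonneg: "0 \<le> E (\<lambda>_. 0)"
    unfolding E_def using rho_nonneg a_nonneg by (intro Bochner_Integration.integral_nonneg) auto
  have le: "E w \<le> E (\<lambda>_. 0)"
    using min E0_nonneg unfolding cube_energy_eq_integral[OF w] cube_energy_eq_integral[OF 0]
    by (simp add: E_def[symmetric])
  have rho_M: "integrable lborel (\<lambda>\<xi>. \<rho> \<xi> * (M \<bullet> \<xi>)\<^sup>2)"
    using lborel_cube.integrable_fst'[OF unit.integrable_increment_sq[OF 0, of M l]]
    by (simp add: increment_def measure_cube_UNIV)
  have "E (\<lambda>_. 0) \<le> (\<integral>(\<xi>, x). (\<beta> * (\<rho> \<xi> * (M \<bullet> \<xi>)\<^sup>2)) * 1 \<partial>?N)"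
    unfolding E_def
  proof (rule integral_mono)
    show "integrable ?N (\<lambda>(\<xi>, x). \<rho> \<xi> * (a x * (increment M l (\<lambda>_. 0) \<xi> x)\<^sup>2))"
      by (rule integrable_energy_density[OF 0])
    show "integrable ?N (\<lambda>(\<xi>, x). (\<beta> * (\<rho> \<xi> * (M \<bullet> \<xi>)\<^sup>2)) * 1)"
      using rho_M by (intro integrable_prod_mult) auto
    have "\<rho> \<xi> * (a x * (M \<bullet> \<xi>)\<^sup>2) \<le> \<rho> \<xi> * (\<beta> * (M \<bullet> \<xi>)\<^sup>2)" for \<xi> x
      by (intro mult_left_mono mult_right_mono a_upper rho_nonneg) auto
    thus "(case p of (\<xi>, x) \<Rightarrow> \<rho> \<xi> * (a x * (increment M l (\<lambda>_. 0) \<xi> x)\<^sup>2))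
       \<le> (case p of (\<xi>, x) \<Rightarrow> (\<beta> * (\<rho> \<xi> * (M \<bullet> \<xi>)\<^sup>2)) * 1)" for p
      by (cases p) (simp add: increment_def mult_ac)
  qed
  also have "\<dots> = \<beta> * (\<integral>\<xi>. \<rho> \<xi> * (M \<bullet> \<xi>)\<^sup>2 \<partial>lborel)"
    using lborel_cube.integral_fst'[OF integrable_prod_mult[of "\<lambda>\<xi>. \<beta> * (\<rho> \<xi> * (M \<bullet> \<xi>)\<^sup>2)" "\<lambda>_ :: real ^ 'n. 1"]] rho_M
    by (simp add: measure_cube_UNIV)
  finally have E0: "E (\<lambda>_. 0) \<le> \<beta> * (\<integral>\<xi>. \<rho> \<xi> * (M \<bullet> \<xi>)\<^sup>2 \<partial>lborel)" .
  have "\<alpha> * S = (\<integral>(\<xi>, x). \<alpha> * (\<rho> \<xi> * (1 * (increment 0 l w \<xi> x)\<^sup>2)) \<partial>?N)"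
    unfolding S_def by (subst integral_mult_right_zero[symmetric]) (simp add: case_prod_unfold)
  also have "\<dots> \<le> (\<integral>p. 2 * (case p of (\<xi>, x) \<Rightarrow> \<rho> \<xi> * (a x * (increment M l w \<xi> x)\<^sup>2)) +
      2 * (case p of (\<xi>, x) \<Rightarrow> \<rho> \<xi> * (a x * (increment M l (\<lambda>_. 0) \<xi> x)\<^sup>2)) \<partial>?N)"
  proof (rule integral_mono)
    show "integrable ?N (\<lambda>(\<xi>, x). \<alpha> * (\<rho> \<xi> * (1 * (increment 0 l w \<xi> x)\<^sup>2)))"
      using integrable_mult_right[OF unit.integrable_energy_density[OF w, of 0 l], of \<alpha>]
      by (simp add: case_prod_unfold)
    show "integrable ?N (\<lambda>p. 2 * (case p of (\<xi>, x) \<Rightarrow> \<rho> \<xi> * (a x * (increment M l w \<xi> x)\<^sup>2)) +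
      2 * (case p of (\<xi>, x) \<Rightarrow> \<rho> \<xi> * (a x * (increment M l (\<lambda>_. 0) \<xi> x)\<^sup>2)))"
      by (intro Bochner_Integration.integrable_add integrable_mult_right integrable_energy_density w 0)
    \<comment> \<open>Here q is the affine part and r the periodic increment, recovered as (q + r) -
      q. The two summands become the energies of \<open>w\<close> and of the affine function; with
      factor 2 each and minimality they give the 4 in the bound.\<close>
    have sq: "\<alpha> * r\<^sup>2 \<le> b * (2 * (q + r)\<^sup>2 + 2 * q\<^sup>2)" if "\<alpha> \<le> b" for q r b :: real
    proof (rule mult_mono)
      show "r\<^sup>2 \<le> 2 * (q + r)\<^sup>2 + 2 * q\<^sup>2"
        using zero_le_power2[of "2 * q + r"] by (simp add: power2_eq_square algebra_simps)
    qed (use that alpha_pos in auto)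
    have "\<rho> \<xi> * (\<alpha> * (increment 0 l w \<xi> x)\<^sup>2) \<le> \<rho> \<xi> * (a x * (2 * (M \<bullet> \<xi> + increment 0 l w \<xi> x)\<^sup>2 + 2 * (M \<bullet> \<xi>)\<^sup>2))" for \<xi> x
      by (intro mult_left_mono sq rho_nonneg a_lower)
    thus "(case p of (\<xi>, x) \<Rightarrow> \<alpha> * (\<rho> \<xi> * (1 * (increment 0 l w \<xi> x)\<^sup>2)))
        \<le> 2 * (case p of (\<xi>, x) \<Rightarrow> \<rho> \<xi> * (a x * (increment M l w \<xi> x)\<^sup>2)) +
      2 * (case p of (\<xi>, x) \<Rightarrow> \<rho> \<xi> * (a x * (increment M l (\<lambda>_. 0) \<xi> x)\<^sup>2))" for p
      by (cases p) (simp add: increment_def algebra_simps)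
  qed
  also have "\<dots> = 2 * E w + 2 * E (\<lambda>_. 0)"
    unfolding E_def using integrable_energy_density[OF w, of M l] integrable_energy_density[OF 0, of M l]
    by simp
  also have "\<dots> \<le> 4 * (\<beta> * (\<integral>\<xi>. \<rho> \<xi> * (M \<bullet> \<xi>)\<^sup>2 \<partial>lborel))"
    using le E0 by simp
  finally have "S \<le> 4 / \<alpha> * (\<beta> * (\<integral>\<xi>. \<rho> \<xi> * (M \<bullet> \<xi>)\<^sup>2 \<partial>lborel))"
    using alpha_pos by (simp add: field_simps)
  moreover have "(\<integral>\<^sup>+\<xi>. ennreal (\<rho> \<xi>) * (\<integral>\<^sup>+x. ennreal ((w (x + l *\<^sub>R \<xi>) - w x)\<^sup>2) \<partial>cube_measure) \<partial>lborel) = ennreal S"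
    using unit.cube_energy_eq_integral[OF w, of l]
    unfolding S_def periodic_cube_energy_def by (simp add: increment_def)
  ultimately show ?thesis by (simp add: ennreal_leI)
qed

end

section \<open>The L1 bound for minimizers of mean zero, and the passage to the limit\<close>

interpretation cube_cube: pair_sigma_finite "cube_measure :: (real ^ 'm) measure" "cube_measure :: (real ^ 'n) measure" ..

lemma cube_L2_imp_integrable:
  assumes "\<phi> \<in> cube_L2"
  shows "integrable cube_measure \<phi>"
proof (rule Bochner_Integration.integrable_bound)
  show "integrable cube_measure (\<lambda>x. 1 + (\<phi> x)\<^sup>2)" using assms by (simp add: cube_L2_def)
  have [measurable]: "\<phi> \<in> borel_measurable borel" using assms by (simp add: cube_L2_def)
  show "\<phi> \<in> borel_measurable cube_measure" by measurable
  show "AE x in cube_measure. norm (\<phi> x) \<le> norm (1 + (\<phi> x)\<^sup>2)"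
    by (intro AE_I2) (simp add: abs_le_one_plus_square)
qed

text \<open>\<open>- w x\<close> is the mean over \<open>z\<close> of \<open>w (x + z) - w x\<close>.\<close>

lemma L1_norm_le_increments:
  assumes w: "w \<in> cube_L2" and mean: "(\<integral>x. w x \<partial>cube_measure) = 0"
  shows "(\<integral>\<^sup>+x. ennreal \<bar>w x\<bar> \<partial>cube_measure)
    \<le> 1 + (\<integral>\<^sup>+z. (\<integral>\<^sup>+x. ennreal ((w (x + z) - w x)\<^sup>2) \<partial>cube_measure) \<partial>cube_measure)"
proof -
  have [measurable]: "w \<in> borel_measurable borel" and per: "lattice_periodic w"
    using w by (auto simp: cube_L2_def)
  have int: "integrable cube_measure (\<lambda>z. w (x + z))" for x
    using integrable_cube_shift[OF per, of x] cube_L2_imp_integrable[OF w] by (simp add: add.commute)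
  have "(\<integral>\<^sup>+x. ennreal \<bar>w x\<bar> \<partial>cube_measure)
      \<le> (\<integral>\<^sup>+x. (\<integral>\<^sup>+z. 1 + ennreal ((w (x + z) - w x)\<^sup>2) \<partial>cube_measure) \<partial>cube_measure)"
  proof (rule nn_integral_mono)
    fix x
    have "(\<integral>z. w (x + z) - w x \<partial>cube_measure) = - w x"
      using int[of x] integral_cube_shift[OF per, of x] mean
      by (simp add: add.commute measure_cube_UNIV)
    hence "ennreal \<bar>w x\<bar> = ennreal (norm (\<integral>z. w (x + z) - w x \<partial>cube_measure))" by simp
    also have "\<dots> \<le> (\<integral>\<^sup>+z. ennreal (norm (w (x + z) - w x)) \<partial>cube_measure)"
      using int[of x] by (intro integral_norm_bound_ennreal) auto
    also have "\<dots> \<le> (\<integral>\<^sup>+z. 1 + ennreal ((w (x + z) - w x)\<^sup>2) \<partial>cube_measure)"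
    proof (rule nn_integral_mono)
      fix z
      show "ennreal (norm (w (x + z) - w x)) \<le> 1 + ennreal ((w (x + z) - w x)\<^sup>2)"
        using ennreal_leI[OF abs_le_one_plus_square[of "w (x + z) - w x"]] by (simp add: ennreal_plus)
    qed
    finally show "ennreal \<bar>w x\<bar> \<le> (\<integral>\<^sup>+z. 1 + ennreal ((w (x + z) - w x)\<^sup>2) \<partial>cube_measure)" .
  qed
  also have "\<dots> = (\<integral>\<^sup>+z. (\<integral>\<^sup>+x. 1 + ennreal ((w (x + z) - w x)\<^sup>2) \<partial>cube_measure) \<partial>cube_measure)"
    by (rule cube_cube.Fubini'[symmetric]) measurable
  also have "\<dots> = 1 + (\<integral>\<^sup>+z. (\<integral>\<^sup>+x. ennreal ((w (x + z) - w x)\<^sup>2) \<partial>cube_measure) \<partial>cube_measure)"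
    by (simp add: nn_integral_add emeasure_cube_measure_space)
  finally show ?thesis .
qed

context periodic_energy
begin

text \<open>The numerator is the bound on the weighted increments, the denominator is the lower
  bound of \<rho> times the volume of the averaging ball, and the leading 1 comes from |t| \<le> 1 +
  t^2. What matters is that neither \<open>l\<close> nor the minimizer enters.\<close>

definition L1_bound :: real where
  "L1_bound = 1 + 4 / \<alpha> * (\<beta> * (\<integral>\<xi>. \<rho> \<xi> * (M \<bullet> \<xi>)\<^sup>2 \<partial>lborel))
     / (c0 * measure lborel (ball (0 :: real ^ 'n) (r0 / 2)))"

text \<open>The squared L2 norm \<open>g z\<close> of the increment by \<open>z\<close> is a
  periodic function of \<open>z\<close>. The energy bounds its weighted integral along
  \<open>l *\<^sub>R \<xi>\<close>, the averaging lower bound passes to its mean over the cube, and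
  that mean bounds \<open>w\<close>. The radius is \<open>r0 / 2\<close> because the averaging
  doubles the ball, which must stay where \<rho> is at least \<open>c0\<close>.\<close>

lemma minimizer_L1_bound:
  assumes w: "w \<in> cube_L2" and mean: "(\<integral>x. w x \<partial>cube_measure) = 0"
    and min: "cube_energy l w \<le> cube_energy l (\<lambda>_. 0)"
    and l: "l > 0" "real CARD('n) \<le> l * (r0 / 2)"
  shows "(\<integral>x. \<bar>w x\<bar> \<partial>cube_measure) \<le> L1_bound"
proof -
  have [measurable]: "w \<in> borel_measurable borel" and per: "lattice_periodic w"
    using w by (auto simp: cube_L2_def)
  define C where "C = 4 / \<alpha> * (\<beta> * (\<integral>\<xi>. \<rho> \<xi> * (M \<bullet> \<xi>)\<^sup>2 \<partial>lborel))"
  define m where "m = measure lborel (ball (0 :: real ^ 'n) (r0 / 2))"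
  have m: "m > 0" unfolding m_def using r0_pos by (intro content_ball_pos) auto
  have em: "emeasure lborel (ball (0 :: real ^ 'n) (r0 / 2)) = ennreal m"
    unfolding m_def by (intro emeasure_eq_ennreal_measure) (use emeasure_lborel_ball_finite[of "0 :: real ^ 'n" "r0 / 2"] in auto)
  have "\<beta> > 0" using alpha_pos a_lower[of 0] a_upper[of 0] by linarith
  hence C: "C \<ge> 0" unfolding C_def using alpha_pos rho_nonneg
    by (intro mult_nonneg_nonneg Bochner_Integration.integral_nonneg) auto
  define g where "g z = (\<integral>\<^sup>+x. ennreal ((w (x + z) - w x)\<^sup>2) \<partial>cube_measure)" for z
  have g_meas [measurable]: "g \<in> borel_measurable borel" unfolding g_def by measurable
  have g_per: "lattice_periodic g"
    using lattice_periodic_shift(2)[OF per] by (auto simp: lattice_periodic_def g_def)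
  have ball [measurable]: "ball (0 :: real ^ 'n) r0 \<in> sets borel" by simp
  have "ennreal c0 * (ennreal m * (\<integral>\<^sup>+z. g z \<partial>cube_measure))
      \<le> ennreal c0 * (\<integral>\<^sup>+\<xi>. indicator (ball 0 r0) \<xi> * g (l *\<^sub>R \<xi>) \<partial>lborel)"
    using averaging_lower_bound[OF g_per g_meas l] by (intro mult_left_mono) (auto simp: em)
  also have "\<dots> = (\<integral>\<^sup>+\<xi>. ennreal c0 * (indicator (ball 0 r0) \<xi> * g (l *\<^sub>R \<xi>)) \<partial>lborel)"
    by (rule nn_integral_cmult[symmetric]) measurable
  also have "\<dots> \<le> (\<integral>\<^sup>+\<xi>. ennreal (\<rho> \<xi>) * g (l *\<^sub>R \<xi>) \<partial>lborel)"
    by (rule nn_integral_mono_AE, rule AE_mp[OF rho_lower])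
       (auto simp: indicator_def intro!: AE_I2 mult_right_mono ennreal_leI)
  also have "\<dots> \<le> ennreal C"
    unfolding g_def C_def by (rule increment_energy_bound[OF w min])
  finally have "ennreal (c0 * m) * (\<integral>\<^sup>+z. g z \<partial>cube_measure) \<le> ennreal C"
    using c0_pos m by (simp add: ennreal_mult mult.assoc)
  hence "ennreal (1 / (c0 * m)) * (ennreal (c0 * m) * (\<integral>\<^sup>+z. g z \<partial>cube_measure)) \<le> ennreal (1 / (c0 * m)) * ennreal C"
    by (rule mult_left_mono) simp
  hence g_le: "(\<integral>\<^sup>+z. g z \<partial>cube_measure) \<le> ennreal (C / (c0 * m))"
    using c0_pos m C by (simp add: mult.assoc[symmetric] ennreal_mult[symmetric])
  have "ennreal (\<integral>x. \<bar>w x\<bar> \<partial>cube_measure) = (\<integral>\<^sup>+x. ennreal \<bar>w x\<bar> \<partial>cube_measure)"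
    using cube_L2_imp_integrable[OF w] by (intro nn_integral_eq_integral[symmetric]) auto
  also have "\<dots> \<le> 1 + (\<integral>\<^sup>+z. g z \<partial>cube_measure)"
    unfolding g_def by (rule L1_norm_le_increments[OF w mean])
  also have "\<dots> \<le> ennreal 1 + ennreal (C / (c0 * m))"
    using g_le by (simp add: add_left_mono)
  also have "\<dots> = ennreal (1 + C / (c0 * m))"
    using C c0_pos m by (intro ennreal_plus[symmetric]) auto
  also have "\<dots> = ennreal L1_bound" by (simp add: L1_bound_def C_def m_def)
  finally show ?thesis
  proof (subst (asm) ennreal_le_iff)
    have "0 \<le> C / (c0 * m)" using C c0_pos m by simp
    thus "0 \<le> L1_bound" unfolding L1_bound_def C_def m_def by linarith
  qed
qed


text \<open>Expanding the Euler--Lagrange equation for the variation \<open>a\<close> gives six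
  integrals of \<tau>(\<xi>) h(x) q(x + s \<xi>). The two without \<open>w\<close> tend to A^2 k and
  A2 k, the other four to 0. In the latter \<open>w\<close> is multiplied by 1, \<open>a\<close> or
  its square, so weak convergence against bounded functions suffices.\<close>

lemma minimizers_limit:
  fixes w :: "nat \<Rightarrow> real ^ 'n \<Rightarrow> real" and l :: "nat \<Rightarrow> real"
  assumes w: "\<And>j. w j \<in> cube_L2" and mean: "\<And>j. (\<integral>x. w j x \<partial>cube_measure) = 0"
    and min0: "\<And>j. cube_energy (l j) (w j) \<le> cube_energy (l j) (\<lambda>_. 0)"
    and min: "\<And>j t. cube_energy (l j) (w j) \<le> cube_energy (l j) (\<lambda>x. w j x + t * a x)"
    and l: "filterlim l at_top sequentially"
    and weak: "\<And>p B. p \<in> borel_measurable borel \<Longrightarrow> (\<And>x. \<bar>p x\<bar> \<le> B) \<Longrightarrow>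
      (\<lambda>j. \<integral>x. w j x * p x \<partial>cube_measure) \<longlonglongrightarrow> 0"
  shows "(\<integral>\<xi>. \<rho> \<xi> * (M \<bullet> \<xi>) \<partial>lborel)
    * ((\<integral>x. a x \<partial>cube_measure)\<^sup>2 - (\<integral>x. (a x)\<^sup>2 \<partial>cube_measure)) = 0"
proof -
  have w_meas [measurable]: "w j \<in> borel_measurable borel" and w_per: "lattice_periodic (w j)" for j
    using w by (auto simp: cube_L2_def)
  have w_int: "integrable cube_measure (w j)" for j by (rule cube_L2_imp_integrable[OF w])
  have a_int: "integrable cube_measure a" by (rule integrable_cube_bounded[OF a_meas a_abs])
  have a_sq_int: "integrable cube_measure (\<lambda>x. (a x)\<^sup>2)"
    by (rule integrable_cube_bounded[OF _ a_sq_abs]) measurable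
  have a_sq_per: "lattice_periodic (\<lambda>x. (a x)\<^sup>2)"
    using a_periodic by (simp add: lattice_periodic_def)
  have a_L2: "a \<in> cube_L2" by (rule bounded_in_cube_L2[OF a_meas a_periodic a_abs])
  have one: "lattice_periodic (\<lambda>_. 1 :: real)" by (simp add: lattice_periodic_def)
  let ?N = "lborel \<Otimes>\<^sub>M cube_measure :: ((real ^ 'n) \<times> (real ^ 'n)) measure"
  define \<sigma> where "\<sigma> \<xi> = \<rho> \<xi> * (M \<bullet> \<xi>)" for \<xi>
  have \<sigma>: "integrable lborel \<sigma>"
  proof (rule Bochner_Integration.integrable_bound)
    show "integrable lborel (\<lambda>\<xi>. norm M * (\<rho> \<xi> + \<rho> \<xi> * (norm \<xi>)\<^sup>2))"
      using rho_int rho_moment by simp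
    show "\<sigma> \<in> borel_measurable lborel" unfolding \<sigma>_def by measurable
    have "\<bar>M \<bullet> \<xi>\<bar> \<le> norm M * (1 + (norm \<xi>)\<^sup>2)" for \<xi>
      using abs_le_one_plus_square[of "norm \<xi>"]
      by (intro order_trans[OF Cauchy_Schwarz_ineq2] mult_left_mono) auto
    hence "\<rho> \<xi> * \<bar>M \<bullet> \<xi>\<bar> \<le> \<rho> \<xi> * (norm M * (1 + (norm \<xi>)\<^sup>2))" for \<xi>
      by (intro mult_left_mono rho_nonneg)
    thus "AE \<xi> in lborel. norm (\<sigma> \<xi>) \<le> norm (norm M * (\<rho> \<xi> + \<rho> \<xi> * (norm \<xi>)\<^sup>2))"
      using rho_nonneg by (intro AE_I2) (simp add: \<sigma>_def abs_mult algebra_simps)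
  qed
  define k where "k = (\<integral>\<xi>. \<sigma> \<xi> \<partial>lborel)"
  define A where "A = (\<integral>x. a x \<partial>cube_measure)"
  define A2 where "A2 = (\<integral>x. (a x)\<^sup>2 \<partial>cube_measure)"
  have l_inf: "filterlim l at_infinity sequentially" "filterlim (\<lambda>j. - l j) at_infinity sequentially"
    using filterlim_at_top_imp_at_infinity[OF l] filterlim_at_top_imp_at_infinity[OF l]
    by (auto simp: filterlim_at_infinity[OF order_refl])
  have l_large: "eventually (\<lambda>j. l j > 0 \<and> real CARD('n) \<le> l j * (r0 / 2)) sequentially"
  proof -
    have "eventually (\<lambda>j. l j \<ge> real CARD('n) / (r0 / 2)) sequentially"
      using l by (auto simp: filterlim_at_top)
    moreover have "eventually (\<lambda>j. l j \<ge> 1) sequentially"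
      using l by (auto simp: filterlim_at_top)
    ultimately show ?thesis
      by eventually_elim (use r0_pos in \<open>auto simp: field_simps\<close>)
  qed
  have w_bound: "eventually (\<lambda>j. (\<integral>x. \<bar>w j x\<bar> \<partial>cube_measure) \<le> L1_bound) sequentially"
    using l_large by eventually_elim (auto intro!: minimizer_L1_bound[OF w mean min0])
  have wp: "integrable cube_measure (\<lambda>x. w j x * p x)"
      "eventually (\<lambda>j. (\<integral>x. \<bar>w j x * p x\<bar> \<partial>cube_measure) \<le> B * L1_bound) sequentially"
    if [measurable]: "p \<in> borel_measurable borel" and p: "\<And>x. \<bar>p x\<bar> \<le> B" for p B j
  proof -
    have int: "integrable cube_measure (\<lambda>x. w j x * p x)" for j
      using p by (intro integrable_mult_bounded[OF w_int]) auto
    thus "integrable cube_measure (\<lambda>x. w j x * p x)" .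
    have B: "0 \<le> B" using p[of 0] by (rule order_trans[OF abs_ge_zero])
    show "eventually (\<lambda>j. (\<integral>x. \<bar>w j x * p x\<bar> \<partial>cube_measure) \<le> B * L1_bound) sequentially"
      using w_bound
    proof eventually_elim
      case (elim j)
      have "(\<integral>x. \<bar>w j x * p x\<bar> \<partial>cube_measure) \<le> (\<integral>x. B * \<bar>w j x\<bar> \<partial>cube_measure)"
      proof (rule integral_mono)
        show "\<bar>w j x * p x\<bar> \<le> B * \<bar>w j x\<bar>" for x
          unfolding abs_mult mult.commute[of B] using p by (intro mult_left_mono) auto
      qed (use int w_int in auto)
      also have "\<dots> \<le> B * L1_bound" using elim B by (simp add: mult_left_mono)
      finally show ?case .
    qed
  qed
  define I where "I \<tau> h q s = (\<integral>(\<xi>, x). \<tau> \<xi> * h x * q (x + s *\<^sub>R \<xi>) \<partial>?N)"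
    for \<tau> h q :: "real ^ 'n \<Rightarrow> real" and s :: real
  have I_int: "integrable ?N (\<lambda>(\<xi>, x). \<tau> \<xi> * h x * q (x + s *\<^sub>R \<xi>))"
    if "integrable lborel \<tau>" "integrable cube_measure h" "q \<in> borel_measurable borel" "\<And>x. \<bar>q x\<bar> \<le> B"
    for \<tau> h q :: "real ^ 'n \<Rightarrow> real" and s B :: real
  proof -
    have [measurable]: "q \<in> borel_measurable borel" by fact
    have "integrable ?N (\<lambda>p. (case p of (\<xi>, x) \<Rightarrow> \<tau> \<xi> * h x) * (case p of (\<xi>, x) \<Rightarrow> q (x + s *\<^sub>R \<xi>)))"
      by (rule integrable_mult_bounded[OF integrable_prod_mult[OF that(1,2)], of _ B]) (use that in auto)
    thus ?thesis by (simp add: case_prod_unfold)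
  qed
  have lim1: "(\<lambda>j. I \<sigma> a a (l j)) \<longlonglongrightarrow> A * (A * k)"
    unfolding I_def A_def k_def
    by (rule averaging_limit[OF \<sigma> a_periodic a_meas a_abs l_inf(1) a_int always_eventually tendsto_const]) auto
  have lim2: "(\<lambda>j. I \<sigma> (\<lambda>x. (a x)\<^sup>2) (\<lambda>_. 1) (l j)) \<longlonglongrightarrow> A2 * k"
    using averaging_limit[OF \<sigma> one _ _ l_inf(1) a_sq_int
        always_eventually[OF allI[OF order_refl]] tendsto_const, of 1]
    by (simp add: I_def A2_def k_def measure_cube_UNIV)
  have limw: "(\<lambda>j. I \<rho> (\<lambda>x. w j x * p x) q (s j)) \<longlonglongrightarrow> 0"
    if "p \<in> borel_measurable borel" "\<And>x. \<bar>p x\<bar> \<le> b" "lattice_periodic q" "q \<in> borel_measurable borel"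
      "\<And>x. \<bar>q x\<bar> \<le> c" "filterlim s at_infinity sequentially" for p q s b c
    using averaging_limit[OF rho_int that(3-6) wp(1)[OF that(1,2)] wp(2)[OF that(1,2)] weak[OF that(1,2)]]
    by (simp add: I_def)
  have lim3: "(\<lambda>j. I \<rho> (\<lambda>x. w j x * a x) a (- l j)) \<longlonglongrightarrow> 0"
    by (rule limw[OF a_meas a_abs a_periodic a_meas a_abs l_inf(2)])
  have lim4: "(\<lambda>j. I \<rho> (\<lambda>x. w j x * 1) (\<lambda>x. (a x)\<^sup>2) (- l j)) \<longlonglongrightarrow> 0"
    by (rule limw[of "\<lambda>_. 1" 1, OF _ _ a_sq_per _ a_sq_abs l_inf(2)]) auto
  have lim5: "(\<lambda>j. I \<rho> (\<lambda>x. w j x * a x) a (l j)) \<longlonglongrightarrow> 0"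
    by (rule limw[OF a_meas a_abs a_periodic a_meas a_abs l_inf(1)])
  have lim6: "(\<lambda>j. I \<rho> (\<lambda>x. w j x * (a x)\<^sup>2) (\<lambda>_. 1) (l j)) \<longlonglongrightarrow> 0"
    by (rule limw[of _ _ _ 1, OF _ a_sq_abs one _ _ l_inf(1)]) auto
  have eq: "I \<sigma> a a (l j) - I \<sigma> (\<lambda>x. (a x)\<^sup>2) (\<lambda>_. 1) (l j)
      + I \<rho> (\<lambda>x. w j x * a x) a (- l j) - I \<rho> (\<lambda>x. w j x * 1) (\<lambda>x. (a x)\<^sup>2) (- l j)
      - I \<rho> (\<lambda>x. w j x * a x) a (l j) + I \<rho> (\<lambda>x. w j x * (a x)\<^sup>2) (\<lambda>_. 1) (l j) = 0" for j
  proof -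
    have int1: "integrable ?N (\<lambda>(\<xi>, x). \<sigma> \<xi> * a x * a (x + l j *\<^sub>R \<xi>))"
      by (rule I_int[OF \<sigma> a_int a_meas a_abs])
    have int2: "integrable ?N (\<lambda>(\<xi>, x). \<sigma> \<xi> * (a x)\<^sup>2 * 1)"
      by (rule I_int[of _ _ _ 1, OF \<sigma> a_sq_int]) auto
    \<comment> \<open>The primed facts concern the third and fourth integrals in the form used for
      the limit, with \<open>w\<close> evaluated at \<open>x\<close>. Translating \<open>x\<close>
      by \<open>l j *\<^sub>R \<xi>\<close> gives the form in which they occur in the
      Euler--Lagrange equation.\<close>
    have int3': "integrable ?N (\<lambda>(\<xi>, x). \<rho> \<xi> * (w j x * a x) * a (x + (- l j) *\<^sub>R \<xi>))"
      by (rule I_int[OF rho_int wp(1)[OF a_meas a_abs] a_meas a_abs])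
    have int4': "integrable ?N (\<lambda>(\<xi>, x). \<rho> \<xi> * (w j x * 1) * (a (x + (- l j) *\<^sub>R \<xi>))\<^sup>2)"
      by (rule I_int[OF rho_int wp(1)[of "\<lambda>_. 1" 1] _ a_sq_abs]) auto
    have int5: "integrable ?N (\<lambda>(\<xi>, x). \<rho> \<xi> * (w j x * a x) * a (x + l j *\<^sub>R \<xi>))"
      by (rule I_int[OF rho_int wp(1)[OF a_meas a_abs] a_meas a_abs])
    have int6: "integrable ?N (\<lambda>(\<xi>, x). \<rho> \<xi> * (w j x * (a x)\<^sup>2) * 1)"
      by (rule I_int[of _ _ _ 1, OF rho_int wp(1)[OF _ a_sq_abs]]) auto
    have per3: "lattice_periodic (\<lambda>x. case (\<xi>, x) of (\<xi>, x) \<Rightarrow> \<rho> \<xi> * (w j x * a x) * a (x + (- l j) *\<^sub>R \<xi>))" for \<xi>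
      using w_per[of j] a_periodic lattice_periodic_shift(1)[OF a_periodic, of "- l j *\<^sub>R \<xi>"]
      by (simp add: lattice_periodic_def)
    have per4: "lattice_periodic (\<lambda>x. case (\<xi>, x) of (\<xi>, x) \<Rightarrow> \<rho> \<xi> * (w j x * 1) * (a (x + (- l j) *\<^sub>R \<xi>))\<^sup>2)" for \<xi>
      using w_per[of j] lattice_periodic_shift(1)[OF a_periodic, of "- l j *\<^sub>R \<xi>"]
      by (simp add: lattice_periodic_def)
    have s_meas: "(\<lambda>\<xi> :: real ^ 'n. l j *\<^sub>R \<xi>) \<in> borel_measurable borel" by measurable
    have int3: "integrable ?N (\<lambda>(\<xi>, x). \<rho> \<xi> * (w j (x + l j *\<^sub>R \<xi>) * a (x + l j *\<^sub>R \<xi>)) * a x)"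
      using integrable_prod_shift[OF per3 s_meas int3'] by simp
    have int4: "integrable ?N (\<lambda>(\<xi>, x). \<rho> \<xi> * w j (x + l j *\<^sub>R \<xi>) * (a x)\<^sup>2)"
      using integrable_prod_shift[OF per4 s_meas int4'] by simp
    have I3: "I \<rho> (\<lambda>x. w j x * a x) a (- l j)
        = (\<integral>(\<xi>, x). \<rho> \<xi> * (w j (x + l j *\<^sub>R \<xi>) * a (x + l j *\<^sub>R \<xi>)) * a x \<partial>?N)"
      using integral_prod_shift[OF per3 s_meas int3'] by (simp add: I_def)
    have I4: "I \<rho> (\<lambda>x. w j x * 1) (\<lambda>x. (a x)\<^sup>2) (- l j)
        = (\<integral>(\<xi>, x). \<rho> \<xi> * w j (x + l j *\<^sub>R \<xi>) * (a x)\<^sup>2 \<partial>?N)"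
      using integral_prod_shift[OF per4 s_meas int4'] by (simp add: I_def)
    have lin: "(\<integral>p. f1 p - f2 p + f3 p - f4 p - f5 p + f6 p \<partial>?N)
        = (\<integral>p. f1 p \<partial>?N) - (\<integral>p. f2 p \<partial>?N) + (\<integral>p. f3 p \<partial>?N)
          - (\<integral>p. f4 p \<partial>?N) - (\<integral>p. f5 p \<partial>?N) + (\<integral>p. f6 p \<partial>?N)"
      if "integrable ?N f1" "integrable ?N f2" "integrable ?N f3" "integrable ?N f4"
        "integrable ?N f5" "integrable ?N f6" for f1 f2 f3 f4 f5 f6 :: "_ \<Rightarrow> real"
      using that by simp
    have "(\<integral>p. (case p of (\<xi>, x) \<Rightarrow> \<sigma> \<xi> * a x * a (x + l j *\<^sub>R \<xi>)) - (case p of (\<xi>, x) \<Rightarrow> \<sigma> \<xi> * (a x)\<^sup>2 * 1)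
        + (case p of (\<xi>, x) \<Rightarrow> \<rho> \<xi> * (w j (x + l j *\<^sub>R \<xi>) * a (x + l j *\<^sub>R \<xi>)) * a x)
        - (case p of (\<xi>, x) \<Rightarrow> \<rho> \<xi> * w j (x + l j *\<^sub>R \<xi>) * (a x)\<^sup>2)
        - (case p of (\<xi>, x) \<Rightarrow> \<rho> \<xi> * (w j x * a x) * a (x + l j *\<^sub>R \<xi>))
        + (case p of (\<xi>, x) \<Rightarrow> \<rho> \<xi> * (w j x * (a x)\<^sup>2) * 1) \<partial>?N)
       = (\<integral>(\<xi>, x). \<rho> \<xi> * (a x * (increment M (l j) (w j) \<xi> x * increment 0 (l j) a \<xi> x)) \<partial>?N)"
      by (rule Bochner_Integration.integral_cong)
         (auto simp: increment_def \<sigma>_def power2_eq_square algebra_simps)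
    also have "\<dots> = 0" by (rule euler_lagrange[OF w a_L2 min])
    finally show ?thesis
      unfolding I3 I4 lin[OF int1 int2 int3 int4 int5 int6] by (simp only: I_def)
  qed
  have "(\<lambda>j. I \<sigma> a a (l j) - I \<sigma> (\<lambda>x. (a x)\<^sup>2) (\<lambda>_. 1) (l j)
      + I \<rho> (\<lambda>x. w j x * a x) a (- l j) - I \<rho> (\<lambda>x. w j x * 1) (\<lambda>x. (a x)\<^sup>2) (- l j)
      - I \<rho> (\<lambda>x. w j x * a x) a (l j) + I \<rho> (\<lambda>x. w j x * (a x)\<^sup>2) (\<lambda>_. 1) (l j))
    \<longlonglongrightarrow> A * (A * k) - A2 * k + 0 - 0 - 0 + 0"
    by (intro tendsto_add tendsto_diff lim1 lim2 lim3 lim4 lim5 lim6)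
  hence "A * (A * k) - A2 * k = 0" unfolding eq by (simp add: LIMSEQ_const_iff)
  thus ?thesis by (simp add: k_def \<sigma>_def A_def A2_def power2_eq_square algebra_simps)
qed

end

section \<open>Periodic representatives\<close>

lemma axis_in_int_lattice: "axis i 1 \<in> int_lattice"
  by (auto simp: int_lattice_def axis_def)

lemma add_in_int_lattice: "k \<in> int_lattice \<Longrightarrow> k' \<in> int_lattice \<Longrightarrow> k + k' \<in> int_lattice"
  by (simp add: int_lattice_def)

lemma uminus_in_int_lattice: "k \<in> int_lattice \<Longrightarrow> - k \<in> int_lattice"
  by (simp add: int_lattice_def)

text \<open>The lattice vectors that are periods of \<open>f\<close> along the orbit of
  \<open>x\<close> form a group, and it contains the generators. A single orbit is considered
  because a representative of an almost everywhere periodic function is well behaved on almost every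
  orbit only.\<close>

lemma int_lattice_translate_invariant:
  assumes inv: "\<And>k i. k \<in> int_lattice \<Longrightarrow> f (x + k + axis i 1) = f (x + k)"
    and k: "k \<in> (int_lattice :: (real ^ 'n) set)"
  shows "f (x + k) = f x"
proof -
  define G where "G = {d \<in> int_lattice. \<forall>k\<in>int_lattice. f (x + k + d) = f (x + k)}"
  have G0: "0 \<in> G" by (auto simp: G_def int_lattice_def)
  have G_add: "d + d' \<in> G" if "d \<in> G" "d' \<in> G" for d d'
  proof -
    have "f (x + k + (d + d')) = f (x + k)" if k: "k \<in> int_lattice" for k
    proof -
      have "f (x + (k + d) + d') = f (x + (k + d))"
        using \<open>d \<in> G\<close> \<open>d' \<in> G\<close> k by (auto simp: G_def intro: add_in_int_lattice)
      also have "\<dots> = f (x + k)" using \<open>d \<in> G\<close> k by (auto simp: G_def add.assoc)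
      finally show ?thesis by (simp add: add.assoc)
    qed
    thus ?thesis using that by (auto simp: G_def add_in_int_lattice)
  qed
  have G_neg: "- d \<in> G" if "d \<in> G" for d
  proof -
    have "f (x + k + - d) = f (x + k)" if k: "k \<in> int_lattice" for k
    proof -
      have "k + - d \<in> int_lattice" using \<open>d \<in> G\<close> k
        by (auto simp: G_def intro: add_in_int_lattice uminus_in_int_lattice simp del: add_uminus_conv_diff)
      hence "f (x + (k + - d) + d) = f (x + (k + - d))" using \<open>d \<in> G\<close> by (auto simp: G_def)
      thus ?thesis by (simp add: add_diff_eq)
    qed
    thus ?thesis using that by (auto simp: G_def uminus_in_int_lattice)
  qed
  have G_nat: "real n *\<^sub>R axis i 1 \<in> G" for n i
  proof (induction n)
    case (Suc n)
    have "axis i 1 \<in> G" using inv by (auto simp: G_def axis_in_int_lattice)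
    from G_add[OF Suc this] show ?case by (simp add: algebra_simps)
  qed (use G0 in simp)
  have G_int: "real_of_int n *\<^sub>R axis i 1 \<in> G" for n i
    using G_nat[of "nat n" i] G_neg[OF G_nat[of "nat (- n)" i]] by (cases "n \<ge> 0") auto
  have "(\<Sum>i\<in>S. k $ i *\<^sub>R axis i 1) \<in> G" if "finite S" for S
    using that
  proof induction
    case (insert i S)
    have "k $ i \<in> \<int>" using k by (simp add: int_lattice_def)
    hence "k $ i *\<^sub>R axis i 1 \<in> G" using G_int by (auto elim!: Ints_cases)
    thus ?case using insert G_add by simp
  qed (use G0 in simp)
  from this[of UNIV] have "k \<in> G"
    using basis_expansion[of k] by (simp add: scalar_mult_eq_scaleR)
  moreover have "(0 :: real ^ 'n) \<in> int_lattice" by (simp add: int_lattice_def)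
  ultimately show ?thesis by (force simp: G_def)
qed

text \<open>Take a Borel version \<open>f'\<close> and compose it with \<open>cube_frac\<close>. For
  almost every \<open>x\<close> the whole countable orbit avoids the null sets where a translation
  by a basis vector changes \<open>f'\<close>, and there the composition does not alter the
  value.\<close>

lemma cube_periodic_representative:
  fixes f :: "real ^ 'n \<Rightarrow> real"
  assumes f: "f \<in> borel_measurable lebesgue" and per: "cube_periodic f"
  shows "\<exists>g. g \<in> borel_measurable borel \<and> lattice_periodic g \<and> (AE x in lborel. f x = g x)"
proof -
  obtain f' where f' [measurable]: "f' \<in> borel_measurable borel" and eq: "AE x in lborel. f x = f' x"
    using completion_ex_borel_measurable_real[OF f] by auto
  have "AE x in lborel. f' (x + axis i 1) = f' x" for i
  proof -
    have "AE x in lborel. f (x + axis i 1) = f x"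
      using per by (simp add: cube_periodic_def AE_completion_iff)
    with eq AE_lborel_shift[OF eq, of "axis i 1"] show ?thesis
      by eventually_elim simp
  qed
  hence "AE x in lborel. \<forall>i. f' (x + axis i 1) = f' x"
    by (subst AE_all_countable) auto
  from AE_lborel_shift[OF this]
  have "AE x in lborel. \<forall>k\<in>int_lattice. \<forall>i. f' (x + k + axis i 1) = f' (x + k)"
    by (subst AE_ball_countable[OF countable_int_lattice]) auto
  with eq have "AE x in lborel. f x = f' (cube_frac x)"
  proof eventually_elim
    case (elim x)
    have "cube_frac x - x \<in> int_lattice"
      using uminus_in_int_lattice[OF diff_cube_frac_in_lattice, of x] by simp
    from int_lattice_translate_invariant[OF _ this, of f' x] elim show ?case by simp
  qed
  moreover have "lattice_periodic (\<lambda>x. f' (cube_frac x))" by (simp add: lattice_periodic_def)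
  moreover have "(\<lambda>x. f' (cube_frac x)) \<in> borel_measurable borel" by measurable
  ultimately show ?thesis by blast
qed

text \<open>The constant \<open>c\<close> cancels in the difference quotient and the factor
  \<open>l\<close> against its denominator. The inner integrals agree for every \<xi>, not just
  almost every one, since translations preserve null sets.\<close>

lemma energy_eq_cube_energy:
  fixes \<rho> a a' u \<phi> :: "real ^ 'n \<Rightarrow> real"
  assumes [measurable]: "a' \<in> borel_measurable borel" "\<phi> \<in> borel_measurable borel"
    and supp: "AE \<xi> in lborel. \<xi> \<notin> ball 0 T \<longrightarrow> \<rho> \<xi> = 0"
    and a: "AE x in lborel. a x = a' x" and u: "AE x in lborel. u x = M \<bullet> x + l * \<phi> x + c"
    and l: "l > 0"
  shows "energy \<rho> a T l u = periodic_cube_energy \<rho> a' M l \<phi>"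
proof -
  have inner: "(\<integral>\<^sup>+x\<in>unit_cube. ennreal (a x * \<bar>(u (x + l *\<^sub>R \<xi>) - u x) / l\<bar>\<^sup>2) \<partial>lebesgue)
      = (\<integral>\<^sup>+x. ennreal (a' x * (increment M l \<phi> \<xi> x)\<^sup>2) \<partial>cube_measure)" for \<xi>
  proof -
    have "(\<integral>\<^sup>+x\<in>unit_cube. ennreal (a x * \<bar>(u (x + l *\<^sub>R \<xi>) - u x) / l\<bar>\<^sup>2) \<partial>lebesgue)
       = (\<integral>\<^sup>+x. ennreal (a x * \<bar>(u (x + l *\<^sub>R \<xi>) - u x) / l\<bar>\<^sup>2) * indicator unit_cube x \<partial>lborel)"
      by (rule nn_integral_completion)
    also have "\<dots> = (\<integral>\<^sup>+x. indicator unit_cube x * ennreal (a' x * (increment M l \<phi> \<xi> x)\<^sup>2) \<partial>lborel)"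
    proof (rule nn_integral_cong_AE)
      show "AE x in lborel. ennreal (a x * \<bar>(u (x + l *\<^sub>R \<xi>) - u x) / l\<bar>\<^sup>2) * indicator unit_cube x
          = indicator unit_cube x * ennreal (a' x * (increment M l \<phi> \<xi> x)\<^sup>2)"
        using a u AE_lborel_shift[OF u, of "l *\<^sub>R \<xi>"]
      proof eventually_elim
        case (elim x)
        have "(u (x + l *\<^sub>R \<xi>) - u x) / l = increment M l \<phi> \<xi> x"
          using l by (simp add: elim increment_def inner_add_right field_simps)
        thus ?case using elim(1) by (simp add: mult.commute)
      qed
    qed
    also have "\<dots> = (\<integral>\<^sup>+x. ennreal (a' x * (increment M l \<phi> \<xi> x)\<^sup>2) \<partial>cube_measure)"
      by (rule nn_integral_cube_measure[symmetric]) measurable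
    finally show ?thesis .
  qed
  have "energy \<rho> a T l u = (\<integral>\<^sup>+\<xi>. ennreal (\<rho> \<xi>) *
      (\<integral>\<^sup>+x. ennreal (a' x * (increment M l \<phi> \<xi> x)\<^sup>2) \<partial>cube_measure) * indicator (ball 0 T) \<xi> \<partial>lborel)"
    unfolding energy_def inner by (rule nn_integral_completion)
  also have "\<dots> = (\<integral>\<^sup>+\<xi>. ennreal (\<rho> \<xi>) * (\<integral>\<^sup>+x. ennreal (a' x * (increment M l \<phi> \<xi> x)\<^sup>2) \<partial>cube_measure) \<partial>lborel)"
    by (rule nn_integral_cong_AE, rule AE_mp[OF supp]) (auto intro!: AE_I2 simp: indicator_def)
  finally show ?thesis by (simp add: periodic_cube_energy_def)
qed

section \<open>Admissible competitors and square integrability of the periodic part\<close>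

lemma integrable_cube_measure_iff:
  fixes f :: "real ^ 'n \<Rightarrow> real"
  assumes [measurable]: "f \<in> borel_measurable borel"
  shows "integrable cube_measure f \<longleftrightarrow> integrable lborel (\<lambda>x. indicator unit_cube x * f x)"
proof -
  have eq: "(cube_measure :: (real ^ 'n) measure) = density lborel (\<lambda>x. ennreal (indicator unit_cube x))"
    by (simp add: cube_measure_def ennreal_indicator)
  show ?thesis
    unfolding eq by (subst integrable_density) auto
qed

lemma bounded_in_L2_on:
  assumes f: "f \<in> borel_measurable lebesgue" and S: "S \<in> lmeasurable"
    and B: "\<And>x. x \<in> S \<Longrightarrow> \<bar>f x\<bar> \<le> B"
  shows "f \<in> L2_on S"
proof -
  interpret finite_measure "lebesgue_on S" by (rule finite_measure_lebesgue_on[OF S])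
  have meas: "f \<in> borel_measurable (lebesgue_on S)" by (rule measurable_restrict_space1[OF f])
  have "\<bar>(f x)\<^sup>2\<bar> \<le> B\<^sup>2" if "x \<in> S" for x
    using B[OF that] by (simp add: abs_le_square_iff[symmetric])
  hence "integrable (lebesgue_on S) (\<lambda>x. (f x)\<^sup>2)"
    using meas by (intro integrable_const_bound[of _ "B\<^sup>2"]) (auto intro!: AE_I2)
  thus ?thesis using meas by (simp add: L2_on_def)
qed

lemma L2_on_add:
  assumes "f \<in> L2_on S" "g \<in> L2_on S"
  shows "(\<lambda>x. f x + g x) \<in> L2_on S"
proof -
  have meas: "(\<lambda>x. f x + g x) \<in> borel_measurable (lebesgue_on S)"
    using assms by (auto simp: L2_on_def)
  have "integrable (lebesgue_on S) (\<lambda>x. (f x + g x)\<^sup>2)"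
  proof (rule Bochner_Integration.integrable_bound)
    show "integrable (lebesgue_on S) (\<lambda>x. 2 * (f x)\<^sup>2 + 2 * (g x)\<^sup>2)"
      using assms by (auto simp: L2_on_def)
    have "(p + q)\<^sup>2 \<le> 2 * p\<^sup>2 + 2 * q\<^sup>2" for p q :: real
      using zero_le_power2[of "p - q"] by (simp add: power2_sum power2_diff)
    thus "AE x in lebesgue_on S. norm ((f x + g x)\<^sup>2) \<le> norm (2 * (f x)\<^sup>2 + 2 * (g x)\<^sup>2)"
      by (intro AE_I2) simp
  qed (use meas in simp)
  thus ?thesis using meas by (simp add: L2_on_def)
qed

lemma linear_in_L2_per: "(\<lambda>x. M \<bullet> x) \<in> L2_per M"
proof -
  have meas: "(\<lambda>x. M \<bullet> x) \<in> borel_measurable lebesgue"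
    by (intro measurable_completion) measurable
  have "(\<lambda>x. M \<bullet> x) \<in> L2_on K" if K: "compact K" for K
  proof -
    obtain B where B: "\<And>x. x \<in> K \<Longrightarrow> norm x \<le> B"
      using compact_imp_bounded[OF K] by (auto simp: bounded_iff)
    show ?thesis
    proof (rule bounded_in_L2_on[OF meas])
      show "K \<in> lmeasurable" using K by (rule lmeasurable_compact)
      show "\<bar>M \<bullet> x\<bar> \<le> norm M * B" if "x \<in> K" for x
        using B[OF that] by (intro order_trans[OF Cauchy_Schwarz_ineq2] mult_left_mono) auto
    qed
  qed
  thus ?thesis using meas by (auto simp: L2_per_def L2_loc_def cube_periodic_def)
qed

lemma L2_per_add_bounded:
  assumes u: "u \<in> L2_per M" and \<psi>: "\<psi> \<in> borel_measurable borel" "lattice_periodic \<psi>" "\<And>x. \<bar>\<psi> x\<bar> \<le> B"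
  shows "(\<lambda>x. u x + \<psi> x) \<in> L2_per M"
proof -
  have meas: "\<psi> \<in> borel_measurable lebesgue" using \<psi>(1) by (intro measurable_completion) simp
  have "\<psi> \<in> L2_on K" if "compact K" for K
    using meas lmeasurable_compact[OF that] \<psi>(3) by (rule bounded_in_L2_on)
  hence "(\<lambda>x. u x + \<psi> x) \<in> L2_loc"
    using u meas by (auto simp: L2_per_def L2_loc_def intro: L2_on_add)
  moreover have "cube_periodic (\<lambda>x. u x + \<psi> x - M \<bullet> x)"
    unfolding cube_periodic_def
  proof
    fix i
    have "AE x in lebesgue. u (x + axis i 1) - M \<bullet> (x + axis i 1) = u x - M \<bullet> x"
      using u by (auto simp: L2_per_def cube_periodic_def)
    thus "AE x in lebesgue. u (x + axis i 1) + \<psi> (x + axis i 1) - M \<bullet> (x + axis i 1) = u x + \<psi> x - M \<bullet> x"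
      by eventually_elim (simp add: lattice_periodic_add[OF \<psi>(2) axis_in_int_lattice] algebra_simps)
  qed
  ultimately show ?thesis by (simp add: L2_per_def)
qed

text \<open>Local square integrability speaks of compact sets, so the estimate is made on the closed
  cube, where the linear part is bounded.\<close>

lemma L2_per_imp_cube_L2:
  fixes u \<phi> :: "real ^ 'n \<Rightarrow> real"
  assumes u: "u \<in> L2_per M" and [measurable]: "\<phi> \<in> borel_measurable borel" and per: "lattice_periodic \<phi>"
    and eq: "AE x in lborel. u x = M \<bullet> x + \<phi> x"
  shows "\<phi> \<in> cube_L2"
proof -
  let ?C = "cbox (0 :: real ^ 'n) 1"
  have sub: "unit_cube \<subseteq> ?C" by (simp add: unit_cube_eq_box box_subset_cbox)
  obtain B where B: "\<And>x. x \<in> ?C \<Longrightarrow> norm x \<le> B"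
    using bounded_cbox[of "0 :: real ^ 'n" 1] unfolding bounded_iff by blast
  define K where "K = norm M * B"
  have K: "\<bar>M \<bullet> x\<bar> \<le> K" if "x \<in> ?C" for x
    unfolding K_def using B[OF that] by (intro order_trans[OF Cauchy_Schwarz_ineq2] mult_left_mono) auto
  have "u \<in> L2_on ?C" using u by (auto simp: L2_per_def L2_loc_def)
  hence "integrable (lebesgue_on ?C) (\<lambda>x. (u x)\<^sup>2)" by (simp add: L2_on_def)
  hence int_u: "integrable lebesgue (\<lambda>x. indicator ?C x *\<^sub>R (u x)\<^sup>2)"
    by (subst (asm) integrable_restrict_space) auto
  have int_K: "integrable lebesgue (\<lambda>x. indicator ?C x *\<^sub>R K\<^sup>2)"
    by (intro integrable_scaleR_left) (auto simp: integrable_indicator_iff emeasure_lborel_cbox_eq)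
  have ind_meas: "(\<lambda>x. indicator unit_cube x * (\<phi> x)\<^sup>2) \<in> borel_measurable lborel" by measurable
  have "integrable lebesgue (\<lambda>x. indicator unit_cube x * (\<phi> x)\<^sup>2)"
  proof (rule Bochner_Integration.integrable_bound)
    show "integrable lebesgue (\<lambda>x. 2 * (indicator ?C x *\<^sub>R (u x)\<^sup>2) + 2 * (indicator ?C x *\<^sub>R K\<^sup>2))"
      by (intro Bochner_Integration.integrable_add integrable_mult_right int_u int_K)
    show "(\<lambda>x. indicator unit_cube x * (\<phi> x)\<^sup>2) \<in> borel_measurable lebesgue"
      by (rule measurable_completion[OF ind_meas])
    have "AE x in lebesgue. u x = M \<bullet> x + \<phi> x" using eq by (simp add: AE_completion_iff)
    thus "AE x in lebesgue. norm (indicator unit_cube x * (\<phi> x)\<^sup>2)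
        \<le> norm (2 * (indicator ?C x *\<^sub>R (u x)\<^sup>2) + 2 * (indicator ?C x *\<^sub>R K\<^sup>2))"
    proof eventually_elim
      case (elim x)
      show ?case
      proof (cases "x \<in> unit_cube")
        case True
        have x: "x \<in> ?C" using True sub by blast
        have "(p - q)\<^sup>2 \<le> 2 * p\<^sup>2 + 2 * q\<^sup>2" for p q :: real
          using zero_le_power2[of "p + q"] by (simp add: power2_sum power2_diff)
        from this[of "u x" "M \<bullet> x"] have "(\<phi> x)\<^sup>2 \<le> 2 * (u x)\<^sup>2 + 2 * (M \<bullet> x)\<^sup>2"
          by (simp add: elim)
        also have "(M \<bullet> x)\<^sup>2 \<le> K\<^sup>2" using K[OF x] abs_le_square_iff[of "M \<bullet> x" K] by auto
        finally show ?thesis using True x by simp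
      qed simp
    qed
  qed
  hence "integrable lborel (\<lambda>x. indicator unit_cube x * (\<phi> x)\<^sup>2)"
    by (simp add: integrable_completion[OF ind_meas])
  thus ?thesis using per by (simp add: cube_L2_def integrable_cube_measure_iff)
qed

section \<open>Weak convergence on the product of two cubes\<close>

lemma unit_cube_square_borel: "unit_cube \<times> unit_cube \<in> sets (borel :: ((real ^ 'n) \<times> (real ^ 'n)) measure)"
  unfolding unit_cube_eq_box by (intro borel_open open_Times open_box)

text \<open>Links the restricted Lebesgue measure of the weak convergence with a product measure, to
  which Fubini applies.\<close>

lemma integral_unit_cube_square:
  fixes h :: "(real ^ 'n) \<times> (real ^ 'n) \<Rightarrow> real"
  assumes [measurable]: "h \<in> borel_measurable borel"
  shows "(LINT z|lebesgue_on (unit_cube \<times> unit_cube). h z) = (\<integral>z. h z \<partial>(cube_measure \<Otimes>\<^sub>M cube_measure))"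
proof -
  let ?S = "unit_cube \<times> unit_cube :: ((real ^ 'n) \<times> (real ^ 'n)) set"
  have S [measurable]: "?S \<in> sets borel"
    by (rule unit_cube_square_borel)
  have h: "h \<in> borel_measurable (borel \<Otimes>\<^sub>M borel)" by (simp add: borel_prod)
  have eq: "(cube_measure \<Otimes>\<^sub>M cube_measure :: ((real ^ 'n) \<times> (real ^ 'n)) measure)
      = density lborel (\<lambda>z. ennreal (indicator ?S z))"
  proof -
    have "(cube_measure \<Otimes>\<^sub>M cube_measure :: ((real ^ 'n) \<times> (real ^ 'n)) measure)
        = density (lborel \<Otimes>\<^sub>M lborel) (\<lambda>(x, y). indicator unit_cube x * indicator unit_cube y)"
      unfolding cube_measure_def
      by (rule pair_measure_density)
         (auto simp: lborel.sigma_finite_measure_axioms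
           cube_measure.sigma_finite_measure_axioms[unfolded cube_measure_def])
    also have "(\<lambda>(x, y). indicator unit_cube x * indicator unit_cube y) = (\<lambda>z. ennreal (indicator ?S z))"
      by (auto simp: fun_eq_iff indicator_def)
    finally show ?thesis by (simp add: lborel_prod)
  qed
  have "(\<integral>z. h z \<partial>(cube_measure \<Otimes>\<^sub>M cube_measure)) = (\<integral>z. indicator ?S z *\<^sub>R h z \<partial>lborel)"
    unfolding eq by (rule integral_density) auto
  also have "\<dots> = (\<integral>z. indicator ?S z *\<^sub>R h z \<partial>lebesgue)"
    by (rule integral_completion[symmetric]) measurable
  also have "\<dots> = (LINT z|lebesgue_on ?S. h z)"
    by (rule integral_restrict_space[symmetric]) simp
  finally show ?thesis ..
qed

text \<open>For fixed first coordinate the sum is a translation, so every section of the exceptional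
  set is null. A Borel null set takes the place of the exceptional set to make the product argument
  measurable.\<close>

lemma AE_lborel_prod_sum:
  fixes R :: "'a :: euclidean_space \<Rightarrow> bool"
  assumes "AE x in lborel. R x"
  shows "AE z in lborel. R (fst z) \<and> R (fst z + snd z)"
proof -
  obtain N where N: "{x. \<not> R x} \<subseteq> N" "N \<in> sets borel" "emeasure lborel N = 0"
    using assms by (auto elim!: AE_E)
  have [measurable]: "N \<in> sets borel" by fact
  have nN: "AE x in lborel. x \<notin> N" using N by (intro AE_not_in) auto
  have "AE z in lborel \<Otimes>\<^sub>M lborel. fst z \<notin> N \<and> fst z + snd z \<notin> N"
  proof (rule lborel_pair.AE_pair_measure)
    show "AE x in lborel. AE y in lborel. fst (x, y) \<notin> N \<and> fst (x, y) + snd (x, y) \<notin> N"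
      using nN
    proof eventually_elim
      case (elim x)
      show ?case using AE_lborel_shift[OF nN, of x] elim by (simp add: add.commute)
    qed
  qed measurable
  hence "AE z in lborel. fst z \<notin> N \<and> fst z + snd z \<notin> N" by (simp only: lborel_prod)
  thus ?thesis by eventually_elim (use N in auto)
qed

text \<open>For fixed \<open>x\<close> the mean of \<open>w (x + \<xi>)\<close> over \<xi> is the
  mean of \<open>w\<close>, that is 0. A test function of \<open>x\<close> alone therefore sees only
  \<open>- w x\<close>.\<close>

lemma weak_pairing_eq:
  fixes w p v :: "real ^ 'n \<Rightarrow> real"
  assumes [measurable]: "w \<in> borel_measurable borel" "p \<in> borel_measurable borel"
    and per: "lattice_periodic w" and int: "integrable cube_measure w" and mean: "(\<integral>x. w x \<partial>cube_measure) = 0"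
    and p: "\<And>x. \<bar>p x\<bar> \<le> B"
    and v: "AE x in lborel. v x = l * w x + c" and l: "l \<noteq> 0"
    and V: "\<And>x \<xi>. V (x, \<xi>) = (v (x + \<xi>) - v x) / l"
    and V_meas: "V \<in> borel_measurable (lebesgue_on (unit_cube \<times> unit_cube))"
  shows "(LINT z|lebesgue_on (unit_cube \<times> unit_cube). V z * p (fst z)) = - (\<integral>x. w x * p x \<partial>cube_measure)"
proof -
  let ?S = "unit_cube \<times> unit_cube :: ((real ^ 'n) \<times> (real ^ 'n)) set"
  have S: "?S \<in> sets lebesgue"
    by (rule sets_completionI_sets) (simp only: sets_lborel unit_cube_square_borel)
  define h where "h z = (w (fst z + snd z) - w (fst z)) * p (fst z)" for z
  have h_meas' [measurable]: "h \<in> borel_measurable (borel \<Otimes>\<^sub>M borel)"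
    unfolding h_def by measurable
  hence h_meas: "h \<in> borel_measurable borel" by (simp add: borel_prod)
  have p_meas: "(\<lambda>z :: (real ^ 'n) \<times> (real ^ 'n). p (fst z)) \<in> borel_measurable borel"
    by (subst borel_prod[symmetric]) measurable
  have "(LINT z|lebesgue_on ?S. V z * p (fst z)) = (LINT z|lebesgue_on ?S. h z)"
  proof (rule integral_cong_AE)
    have "(\<lambda>z :: (real ^ 'n) \<times> (real ^ 'n). p (fst z)) \<in> borel_measurable (lebesgue_on ?S)"
      using p_meas by (intro measurable_restrict_space1 measurable_completion) simp
    thus "(\<lambda>z. V z * p (fst z)) \<in> borel_measurable (lebesgue_on ?S)"
      using V_meas by (rule borel_measurable_times[rotated])
    show "h \<in> borel_measurable (lebesgue_on ?S)"
      using h_meas by (intro measurable_restrict_space1 measurable_completion) simp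
    have "AE z in lebesgue. v (fst z) = l * w (fst z) + c \<and> v (fst z + snd z) = l * w (fst z + snd z) + c"
      using AE_lborel_prod_sum[OF v] by (simp add: AE_completion_iff)
    hence "AE z in lebesgue. V z * p (fst z) = h z"
    proof eventually_elim
      case (elim z)
      have "V z = (v (fst z + snd z) - v (fst z)) / l" using V[of "fst z" "snd z"] by simp
      also have "\<dots> = w (fst z + snd z) - w (fst z)" using l by (simp add: elim field_simps)
      finally show ?case by (simp add: h_def)
    qed
    thus "AE z in lebesgue_on ?S. V z * p (fst z) = h z"
      using S by (subst AE_restrict_space_iff) auto
  qed
  also have "\<dots> = (\<integral>z. h z \<partial>(cube_measure \<Otimes>\<^sub>M cube_measure))"
    by (rule integral_unit_cube_square[OF h_meas])
  also have "\<dots> = (\<integral>x. (\<integral>\<xi>. h (x, \<xi>) \<partial>cube_measure) \<partial>cube_measure)"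
  proof (rule cube_cube.integral_fst'[symmetric])
    have int_abs: "integrable cube_measure (\<lambda>x. \<bar>w x\<bar>)" using int by simp
    have abs_per: "lattice_periodic (\<lambda>x. \<bar>w x\<bar>)" using per by (simp add: lattice_periodic_def)
    have 1: "integrable (cube_measure \<Otimes>\<^sub>M cube_measure) (\<lambda>(x, \<xi>). w (x + \<xi>))"
    proof (rule cube_cube.Fubini_integrable)
      show "integrable cube_measure (\<lambda>x. \<integral>\<xi>. norm (case (x, \<xi>) of (x, \<xi>) \<Rightarrow> w (x + \<xi>)) \<partial>cube_measure)"
        using integral_cube_shift[OF abs_per] by (simp add: add.commute)
      show "AE x in cube_measure. integrable cube_measure (\<lambda>\<xi>. case (x, \<xi>) of (x, \<xi>) \<Rightarrow> w (x + \<xi>))"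
        using integrable_cube_shift[OF per] int by (simp add: add.commute)
    qed measurable
    have 2: "integrable (cube_measure \<Otimes>\<^sub>M cube_measure) (\<lambda>(x, \<xi> :: real ^ 'n). w x)"
      using int by (intro cube_cube.Fubini_integrable) (auto simp: measure_cube_UNIV)
    have "integrable (cube_measure \<Otimes>\<^sub>M cube_measure)
        (\<lambda>z. ((case z of (x, \<xi>) \<Rightarrow> w (x + \<xi>)) - (case z of (x, \<xi>) \<Rightarrow> w x)) * (case z of (x, \<xi> :: real ^ 'n) \<Rightarrow> p x))"
      by (rule integrable_mult_bounded[OF Bochner_Integration.integrable_diff[OF 1 2], of _ B]) (use p in auto)
    thus "integrable (cube_measure \<Otimes>\<^sub>M cube_measure) h"
      by (simp add: h_def[abs_def] case_prod_unfold)
  qed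
  also have "\<dots> = (\<integral>x. - (w x * p x) \<partial>cube_measure)"
  proof (rule Bochner_Integration.integral_cong)
    fix x
    have int_x: "integrable cube_measure (\<lambda>\<xi>. w (x + \<xi>))"
      using integrable_cube_shift[OF per, of x] int by (simp add: add.commute)
    have "(\<integral>\<xi>. w (x + \<xi>) \<partial>cube_measure) = 0"
      using integral_cube_shift[OF per, of x] mean by (simp add: add.commute)
    thus "(\<integral>\<xi>. h (x, \<xi>) \<partial>cube_measure) = - (w x * p x)"
      using int_x by (simp add: h_def measure_cube_UNIV)
  qed simp
  finally show ?thesis by simp
qed

lemma unit_cube_square_lmeasurable:
  "unit_cube \<times> unit_cube \<in> (lmeasurable :: ((real ^ 'n) \<times> (real ^ 'n)) set set)"
proof (rule bounded_set_imp_lmeasurable)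
  show "bounded (unit_cube \<times> unit_cube :: ((real ^ 'n) \<times> (real ^ 'n)) set)"
    unfolding unit_cube_eq_box by (intro bounded_Times bounded_box)
  show "unit_cube \<times> unit_cube \<in> sets (lebesgue :: ((real ^ 'n) \<times> (real ^ 'n)) measure)"
    by (rule sets_completionI_sets) (simp only: sets_lborel unit_cube_square_borel)
qed

theorem proposition3p9:
  fixes \<epsilon> \<delta> lam :: "nat \<Rightarrow> real"
    and T c0 r0 \<alpha> \<beta> :: real
    and \<rho> a :: "real ^ 'n \<Rightarrow> real"
    and M :: "real ^ 'n"
    and u v :: "nat \<Rightarrow> real ^ 'n \<Rightarrow> real"
    and V :: "nat \<Rightarrow> (real ^ 'n) \<times> (real ^ 'n) \<Rightarrow> real"
  assumes eps_pos: "\<And>j. \<epsilon> j > 0" and delta_pos: "\<And>j. \<delta> j > 0"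
    and eps_lim: "\<epsilon> \<longlonglongrightarrow> 0" and delta_lim: "\<delta> \<longlonglongrightarrow> 0"
    and lam_eq: "\<And>j. lam j = \<epsilon> j / \<delta> j"
    and lam_lim: "filterlim lam at_top sequentially"
    and T_pos: "T > 0"
    and rho_borel: "\<rho> \<in> borel_measurable borel"
    and rho_nonneg: "\<And>\<xi>. \<rho> \<xi> \<ge> 0"
    and rho_L1: "integrable lebesgue \<rho>"
    and rho_Linf: "\<exists>C. AE \<xi> in lebesgue. \<rho> \<xi> \<le> C"
    and rho_supp: "AE \<xi> in lebesgue. \<xi> \<notin> ball 0 T \<longrightarrow> \<rho> \<xi> = 0"
    and c0_pos: "c0 > 0" and r0_pos: "r0 > 0"
    and rho_lower: "AE \<xi> in lebesgue. \<xi> \<in> ball 0 r0 \<longrightarrow> \<rho> \<xi> \<ge> c0"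
    and rho_moment: "integrable lebesgue (\<lambda>\<xi>. \<rho> \<xi> * (norm \<xi>)\<^sup>2)"
    and a_meas: "a \<in> borel_measurable lebesgue"
    and a_periodic: "cube_periodic a"
    and a_nonconst: "\<not> (\<exists>c. AE x in lebesgue. a x = c)"
    and alpha_pos: "0 < \<alpha>"
    and a_bounds: "AE x in lebesgue. \<alpha> \<le> a x \<and> a x \<le> \<beta>"
    and M_nz: "M \<noteq> 0"
    and u_min: "\<And>j. is_arg_min (energy \<rho> a T (lam j)) (\<lambda>w. w \<in> L2_per M) (u j)"
    and v_def: "\<And>j x. v j x = u j x - M \<bullet> x"
    and V_def: "\<And>j x \<xi>. V j (x, \<xi>) = (v j (x + \<xi>) - v j x) / lam j"
    and V_weak: "weakly_converges_L2 (unit_cube \<times> unit_cube) V (\<lambda>_. 0)"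
  shows "(LINT \<xi>:ball 0 T|lebesgue. \<rho> \<xi> * (M \<bullet> \<xi>)) = 0"
proof -
  have lam_pos: "lam j > 0" for j using eps_pos delta_pos by (simp add: lam_eq)
  have rho_meas: "\<rho> \<in> borel_measurable lborel" using rho_borel by simp
  have rho_int: "integrable lborel \<rho>"
    using rho_L1 by (simp add: integrable_completion[OF rho_meas])
  have mom_meas: "(\<lambda>\<xi>. \<rho> \<xi> * (norm \<xi>)\<^sup>2) \<in> borel_measurable lborel"
    using rho_meas by measurable
  have rho_mom: "integrable lborel (\<lambda>\<xi>. \<rho> \<xi> * (norm \<xi>)\<^sup>2)"
    using rho_moment by (simp add: integrable_completion[OF mom_meas])
  have supp: "AE \<xi> in lborel. \<xi> \<notin> ball 0 T \<longrightarrow> \<rho> \<xi> = 0"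
    using rho_supp unfolding AE_completion_iff .
  have lower: "AE \<xi> in lborel. \<xi> \<in> ball 0 r0 \<longrightarrow> c0 \<le> \<rho> \<xi>"
    using rho_lower unfolding AE_completion_iff .
  have bounds: "AE x in lborel. \<alpha> \<le> a x \<and> a x \<le> \<beta>"
    using a_bounds unfolding AE_completion_iff .
  \<comment> \<open>The bounds hold at some point because the whole space is not null. Without this
    the truncation below could not satisfy both of them.\<close>
  have \<alpha>\<beta>: "\<alpha> \<le> \<beta>"
  proof (rule ccontr)
    assume "\<not> \<alpha> \<le> \<beta>"
    from bounds have "AE x in (lborel :: (real ^ 'n) measure). False"
      by eventually_elim (use \<open>\<not> \<alpha> \<le> \<beta>\<close> in linarith)
    thus False by (simp add: eventually_False ae_filter_eq_bot_iff)
  qed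
  obtain a1 where a1 [measurable]: "a1 \<in> borel_measurable borel" and a1_per: "lattice_periodic a1"
    and a1_eq: "AE x in lborel. a x = a1 x"
    using cube_periodic_representative[OF a_meas a_periodic] by blast
  \<comment> \<open>Truncation makes the bounds hold everywhere, preserves periodicity, and changes
    \<open>a1\<close> only on a null set.\<close>
  define a' where "a' x = max \<alpha> (min \<beta> (a1 x))" for x
  have a'_eq: "AE x in lborel. a x = a' x"
    using a1_eq bounds by eventually_elim (auto simp: a'_def)
  have a'_meas [measurable]: "a' \<in> borel_measurable borel"
    unfolding a'_def by measurable
  have a'_per: "lattice_periodic a'" using a1_per by (simp add: lattice_periodic_def a'_def)
  interpret periodic_energy \<rho> a' M \<alpha> \<beta> c0 r0
    using rho_int rho_nonneg rho_mom c0_pos r0_pos lower a'_per alpha_pos \<alpha>\<beta>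
    by unfold_locales (auto simp: a'_def)

  have u_L2: "u j \<in> L2_per M" for j
    using u_min[of j] by (simp add: is_arg_min_def)
  have u_le: "energy \<rho> a T (lam j) (u j) \<le> energy \<rho> a T (lam j) y" if "y \<in> L2_per M" for j y
    using u_min[of j] that by (auto simp: is_arg_min_def not_less)
  have "\<exists>g. g \<in> borel_measurable borel \<and> lattice_periodic g \<and> (AE x in lborel. v j x = g x)" for j
  proof (rule cube_periodic_representative)
    have "(\<lambda>x. M \<bullet> x) \<in> borel_measurable lebesgue"
      by (intro measurable_completion) measurable
    moreover have "u j \<in> borel_measurable lebesgue" using u_L2[of j] by (simp add: L2_per_def L2_loc_def)
    ultimately show "v j \<in> borel_measurable lebesgue" unfolding v_def[abs_def] by measurable
    show "cube_periodic (v j)" using u_L2[of j] by (simp add: L2_per_def v_def[abs_def])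
  qed
  then obtain g where g_meas [measurable]: "\<And>j. g j \<in> borel_measurable borel"
    and g_per: "\<And>j. lattice_periodic (g j)" and g_eq: "\<And>j. AE x in lborel. v j x = g j x"
    by metis
  have g_L2: "g j \<in> cube_L2" for j
  proof (rule L2_per_imp_cube_L2[OF u_L2 g_meas g_per])
    show "AE x in lborel. u j x = M \<bullet> x + g j x"
      using g_eq[of j] by eventually_elim (simp add: v_def algebra_simps)
  qed
  define c where "c j = (\<integral>x. g j x \<partial>cube_measure)" for j
  \<comment> \<open>Subtracting the mean affects neither the energy nor the increments, and gives
    the mean zero that both the L1 bound and the pairing with \<open>V j\<close> rely on.\<close>
  define w where "w j x = (g j x - c j) / lam j" for j x
  have w_L2: "w j \<in> cube_L2" for j
  proof -
    have "(\<lambda>_. - c j) \<in> cube_L2"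
      by (rule bounded_in_cube_L2[of _ "\<bar>c j\<bar>"]) (auto simp: lattice_periodic_def)
    from cube_L2_add[OF g_L2[of j] this] show ?thesis
      by (auto simp: cube_L2_def w_def[abs_def] lattice_periodic_def power_divide)
  qed
  have w_meas [measurable]: "w j \<in> borel_measurable borel" and w_per: "lattice_periodic (w j)" for j
    using w_L2[of j] by (auto simp: cube_L2_def)
  have w_mean: "(\<integral>x. w j x \<partial>cube_measure) = 0" for j
    using cube_L2_imp_integrable[OF g_L2[of j]] by (simp add: w_def c_def measure_cube_UNIV)
  have v_eq: "AE x in lborel. v j x = lam j * w j x + c j" for j
    using g_eq[of j] by eventually_elim (use lam_pos[of j] in \<open>simp add: w_def\<close>)
  have u_eq: "AE x in lborel. u j x = M \<bullet> x + lam j * w j x + c j" for j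
    using v_eq[of j] by eventually_elim (simp add: v_def algebra_simps)
  note energy_eq = energy_eq_cube_energy[OF a'_meas _ supp a'_eq _ lam_pos]
  have E_u: "energy \<rho> a T (lam j) (u j) = cube_energy (lam j) (w j)" for j
    by (rule energy_eq[OF w_meas u_eq])
  have min0: "cube_energy (lam j) (w j) \<le> cube_energy (lam j) (\<lambda>_. 0)" for j
  proof -
    have "energy \<rho> a T (lam j) (\<lambda>x. M \<bullet> x) = cube_energy (lam j) (\<lambda>_. 0)"
      by (rule energy_eq[where c = 0]) auto
    thus ?thesis using u_le[OF linear_in_L2_per, of j] by (simp add: E_u)
  qed
  \<comment> \<open>A variation \<open>t * a'\<close> of the rescaled function is the variation
    \<open>lam j * t * a'\<close> of \<open>u j\<close>, which is bounded and periodic and so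
    preserves admissibility.\<close>
  have min: "cube_energy (lam j) (w j) \<le> cube_energy (lam j) (\<lambda>x. w j x + t * a' x)" for j t
  proof -
    have "\<bar>lam j * t * a' x\<bar> \<le> \<bar>lam j * t\<bar> * \<beta>" for x
      unfolding abs_mult[of _ "a' x"] by (intro mult_left_mono a_abs) auto
    hence mem: "(\<lambda>x. u j x + lam j * t * a' x) \<in> L2_per M"
      using a'_per by (intro L2_per_add_bounded[OF u_L2]) (auto simp: lattice_periodic_def)
    have "energy \<rho> a T (lam j) (\<lambda>x. u j x + lam j * t * a' x) = cube_energy (lam j) (\<lambda>x. w j x + t * a' x)"
    proof (rule energy_eq)
      show "AE x in lborel. u j x + lam j * t * a' x = M \<bullet> x + lam j * (w j x + t * a' x) + c j"
        using u_eq[of j] by eventually_elim (simp add: algebra_simps)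
    qed measurable
    thus ?thesis using u_le[OF mem, of j] by (simp add: E_u)
  qed
  have weak: "(\<lambda>j. \<integral>x. w j x * p x \<partial>cube_measure) \<longlonglongrightarrow> 0"
    if p: "p \<in> borel_measurable borel" "\<And>x. \<bar>p x\<bar> \<le> B" for p B
  proof -
    let ?S = "unit_cube \<times> unit_cube :: ((real ^ 'n) \<times> (real ^ 'n)) set"
    note p(1) [measurable]
    have p_meas: "(\<lambda>z :: (real ^ 'n) \<times> (real ^ 'n). p (fst z)) \<in> borel_measurable borel"
      by (subst borel_prod[symmetric]) measurable
    have p_L2: "(\<lambda>z. p (fst z)) \<in> L2_on ?S"
    proof (rule bounded_in_L2_on)
      show "(\<lambda>z :: (real ^ 'n) \<times> (real ^ 'n). p (fst z)) \<in> borel_measurable lebesgue"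
        using p_meas by (intro measurable_completion) simp
      show "?S \<in> lmeasurable" by (rule unit_cube_square_lmeasurable)
    qed (use p in auto)
    have "\<forall>\<phi>\<in>L2_on ?S. (\<lambda>j. LINT z|lebesgue_on ?S. V j z * \<phi> z) \<longlonglongrightarrow> (LINT z|lebesgue_on ?S. 0 * \<phi> z)"
      using V_weak by (simp add: weakly_converges_L2_def)
    from bspec[OF this p_L2] have "(\<lambda>j. LINT z|lebesgue_on ?S. V j z * p (fst z)) \<longlonglongrightarrow> (LINT z|lebesgue_on ?S. 0 * p (fst z))" .
    moreover have "(LINT z|lebesgue_on ?S. V j z * p (fst z)) = - (\<integral>x. w j x * p x \<partial>cube_measure)" for j
    proof (rule weak_pairing_eq[OF w_meas p(1) w_per cube_L2_imp_integrable[OF w_L2] w_mean p(2) v_eq _ V_def])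
      show "V j \<in> borel_measurable (lebesgue_on ?S)"
        using V_weak by (simp add: weakly_converges_L2_def L2_on_def)
    qed (use lam_pos[of j] in simp)
    ultimately have "(\<lambda>j. - (\<integral>x. w j x * p x \<partial>cube_measure)) \<longlonglongrightarrow> 0" by simp
    from tendsto_minus[OF this] show ?thesis by simp
  qed
  have key: "(\<integral>\<xi>. \<rho> \<xi> * (M \<bullet> \<xi>) \<partial>lborel)
      * ((\<integral>x. a' x \<partial>cube_measure)\<^sup>2 - (\<integral>x. (a' x)\<^sup>2 \<partial>cube_measure)) = 0"
    by (rule minimizers_limit[OF w_L2 w_mean min0 min lam_lim weak])

  have "(\<integral>x. a' x \<partial>cube_measure)\<^sup>2 \<noteq> (\<integral>x. (a' x)\<^sup>2 \<partial>cube_measure)"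
  proof
    define A where "A = (\<integral>x. a' x \<partial>cube_measure)"
    assume "(\<integral>x. a' x \<partial>cube_measure)\<^sup>2 = (\<integral>x. (a' x)\<^sup>2 \<partial>cube_measure)"
    hence A: "(\<integral>x. (a' x)\<^sup>2 \<partial>cube_measure) = A\<^sup>2" by (simp add: A_def)
    have int: "integrable cube_measure a'" "integrable cube_measure (\<lambda>x. (a' x)\<^sup>2)"
      by (rule integrable_cube_bounded[OF a'_meas a_abs])
         (rule integrable_cube_bounded[OF _ a_sq_abs], measurable)
    have int_sq: "integrable cube_measure (\<lambda>x. (a' x - A)\<^sup>2)"
      using int by (simp add: power2_diff)
    \<comment> \<open>Zero variance would force \<open>a'\<close> to equal its mean almost
      everywhere on the cube, hence by periodicity on the whole space, against the assumption that
      \<open>a\<close> is not constant.\<close>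
    have "(\<integral>x. (a' x - A)\<^sup>2 \<partial>cube_measure) = A\<^sup>2 + A\<^sup>2 - 2 * A * A"
      using int A by (simp add: power2_diff measure_cube_UNIV A_def[symmetric])
    hence "(\<integral>x. (a' x - A)\<^sup>2 \<partial>cube_measure) = 0" by (simp add: power2_eq_square)
    hence "AE x in cube_measure. (a' x - A)\<^sup>2 = 0"
      using int_sq by (subst (asm) integral_nonneg_eq_0_iff_AE) auto
    hence "AE x in cube_measure. a' x = A" by simp
    hence "AE x in lborel. a' x = A"
      using a'_per by (intro AE_lborel_if_AE_cube) (auto simp: lattice_periodic_def)
    with a'_eq have "AE x in lborel. a x = A" by eventually_elim simp
    hence "AE x in lebesgue. a x = A" by (simp add: AE_completion_iff)
    thus False using a_nonconst by blast
  qed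
  with key have zero: "(\<integral>\<xi>. \<rho> \<xi> * (M \<bullet> \<xi>) \<partial>lborel) = 0" by simp
  have meas: "(\<lambda>\<xi>. \<rho> \<xi> * (M \<bullet> \<xi>)) \<in> borel_measurable lborel"
    using rho_meas by measurable
  have "(LINT \<xi>:ball 0 T|lebesgue. \<rho> \<xi> * (M \<bullet> \<xi>)) = (\<integral>\<xi>. \<rho> \<xi> * (M \<bullet> \<xi>) \<partial>lebesgue)"
    unfolding set_lebesgue_integral_def
  proof (rule integral_cong_AE)
    show "(\<lambda>\<xi>. \<rho> \<xi> * (M \<bullet> \<xi>)) \<in> borel_measurable lebesgue" by (rule measurable_completion[OF meas])
    thus "(\<lambda>\<xi>. indicator (ball 0 T) \<xi> *\<^sub>R (\<rho> \<xi> * (M \<bullet> \<xi>))) \<in> borel_measurable lebesgue"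
      by (intro borel_measurable_scaleR borel_measurable_indicator) simp_all
    show "AE \<xi> in lebesgue. indicator (ball 0 T) \<xi> *\<^sub>R (\<rho> \<xi> * (M \<bullet> \<xi>)) = \<rho> \<xi> * (M \<bullet> \<xi>)"
      using rho_supp by eventually_elim (auto simp: indicator_def)
  qed
  also have "\<dots> = (\<integral>\<xi>. \<rho> \<xi> * (M \<bullet> \<xi>) \<partial>lborel)" by (rule integral_completion[OF meas])
  finally show ?thesis by (simp only: zero)
qed

end
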